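(* Let $I$ and $J$ be two skew-symmetric $(1,1)$-tensors on a pre-Courant algebroid $(E,\Theta)$. If $(I,J)$ is a Nijenhuis pair for $\Theta$, then for all $m,n,t\in\mathbb{N}$, $(I^{2m+1}\circ J^n,J^{2t+1})$ is a Nijenhuis pair for $\Theta_{T_1,T_2,\dots,T_s}$, for all $s\in\mathbb{N}$, where $T_i$ stands either for $I$ or for $J$, for every $i=1,\dots,s$.
   Context: $E\to M$ is a real vector bundle over a smooth manifold with a fibrewise non-degenerate symmetric bilinear form $\langle\cdot,\cdot\rangle$. A pre-Courant structure $\Theta$ on it is a pair $(\rho,[\cdot,\cdot])$, where $\rho:E\to TM$ is a bundle map and $[\cdot,\cdot]$ is an $\mathbb{R}$-bilinear, not necessarily skew-symmetric, bracket on $\Gamma(E)$ such that, for all $X,Y,Z\in\Gamma(E)$, $\rho(X)\cdot\langle Y,Z\rangle=\langle[X,Y],Z\rangle+\langle Y,[X,Z]\rangle$ and $\rho(X)\cdot\langle Y,Z\rangle=\langle X,[Y,Z]+[Z,Y]\rangle$. Then $(E,\Theta)$ is a pre-Courant algebroid. Sums of pre-Courant structures are taken componentwise. A $(1,1)$-tensor is a vector bundle endomorphism of $E$ over $\mathrm{id}_M$; $J$ is skew-symmetric if $\langle Ju,v\rangle+\langle u,Jv\rangle=0$. For $J$ skew-symmetric, $\Theta_J=(\rho\circ J,[\cdot,\cdot]_J)$ with $[X,Y]_J=[JX,Y]+[X,JY]-J[X,Y]$, which is again a pre-Courant structure. Write $\Theta_{T_1,\dots,T_s}=(((\Theta_{T_1})_{T_2})_{\dots})_{T_s}$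 for successive deformations (equal to $\Theta$ for $s=0$). $I^n$ is the $n$-fold composition, $I^0=\mathrm{id}_E$. $\mathbb{N}$ includes $0$. $I$ is Nijenhuis for $\Theta$ if $[IX,IY]-I([X,Y]_I)=0$ for all $X,Y\in\Gamma(E)$. A pair of skew-symmetric $(1,1)$-tensors $(I,J)$ is a compatible pair w.r.t. $\Theta$ if $I\circ J=-J\circ I$ and $C_\Theta(I,J):=\Theta_{I,J}+\Theta_{J,I}=0$. $(I,J)$ is a Nijenhuis pair for $\Theta$ if $I$ and $J$ are skew-symmetric, $(I,J)$ is a compatible pair w.r.t. $\Theta$, and $I$ and $J$ are both Nijenhuis for $\Theta$. *)

theory Defs
  imports "HOL-Analysis.Analysis" "HOL-Library.Function_Algebras" "HOL-Library.Product_Plus"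
begin

section \<open>Pointwise real vector space structure on function types\<close>

instantiation "fun" :: (type, scaleR) scaleR
begin
definition scaleR_fun :: "real \<Rightarrow> ('a \<Rightarrow> 'b) \<Rightarrow> 'a \<Rightarrow> 'b" where
  "scaleR_fun c f = (\<lambda>x. c *\<^sub>R f x)"
instance ..
end

instance "fun" :: (type, real_vector) real_vector
  by standard (auto simp: scaleR_fun_def fun_eq_iff algebra_simps)

lemma scaleR_fun_apply [simp]: "(c *\<^sub>R f) x = c *\<^sub>R f x"
  by (simp add: scaleR_fun_def)


section \<open>Smooth functions on open subsets of Euclidean spaces\<close>

text \<open>
  The space \<open>\<real>\<^sup>n\<close>, \<open>n \<ge> 0\<close>, is \<^const>\<open>Euclidean_space\<close> \<open>n\<close>, i.e. the sequences vanishing from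
  index \<open>n\<close> on. This (rather than a type of class \<^class>\<open>euclidean_space\<close>) keeps
  zero-dimensional manifolds.
\<close>

definition partial_deriv :: "nat \<Rightarrow> ((nat \<Rightarrow> real) \<Rightarrow> real) \<Rightarrow> (nat \<Rightarrow> real) \<Rightarrow> real" where
  "partial_deriv i f x = deriv (\<lambda>t. f (x(i := t))) (x i)"

text \<open>All iterated partial derivatives up to order \<open>k\<close> exist and are continuous on the open set \<open>S\<close>.\<close>

primrec Ck_on :: "nat \<Rightarrow> nat \<Rightarrow> (nat \<Rightarrow> real) set \<Rightarrow> ((nat \<Rightarrow> real) \<Rightarrow> real) \<Rightarrow> bool" where
  "Ck_on n 0 S f \<longleftrightarrow> continuous_map (subtopology (Euclidean_space n) S) euclideanreal f"
| "Ck_on n (Suc k) S f \<longleftrightarrow>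
     continuous_map (subtopology (Euclidean_space n) S) euclideanreal f \<and>
     (\<forall>i<n. (\<forall>x\<in>S. (\<lambda>t. f (x(i := t))) field_differentiable (at (x i))) \<and>
            Ck_on n k S (partial_deriv i f))"

definition Cinf_on :: "nat \<Rightarrow> (nat \<Rightarrow> real) set \<Rightarrow> ((nat \<Rightarrow> real) \<Rightarrow> real) \<Rightarrow> bool" where
  "Cinf_on n S f \<longleftrightarrow> (\<forall>k. Ck_on n k S f)"


section \<open>Smooth manifolds\<close>

text \<open>
  The underlying topological space is the type \<open>'m\<close>; the smooth structure is given by an atlas,
  not necessarily maximal, of charts \<open>(U, \<phi>)\<close>.
\<close>

record 'm manifold =
  mdim :: nat
  charts :: "('m set \<times> ('m \<Rightarrow> nat \<Rightarrow> real)) set"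

definition smooth_manifold :: "'m::{t2_space,second_countable_topology} manifold \<Rightarrow> bool" where
  "smooth_manifold M \<longleftrightarrow>
     (\<Union>(U, \<phi>)\<in>charts M. U) = UNIV \<and>
     (\<forall>(U, \<phi>)\<in>charts M.
        open U \<and> openin (Euclidean_space (mdim M)) (\<phi> ` U) \<and>
        homeomorphic_map (subtopology euclidean U)
          (subtopology (Euclidean_space (mdim M)) (\<phi> ` U)) \<phi>) \<and>
     (\<forall>(U, \<phi>)\<in>charts M. \<forall>(V, \<psi>)\<in>charts M. \<forall>i<mdim M.
        Cinf_on (mdim M) (\<phi> ` (U \<inter> V)) (\<lambda>z. \<psi> (inv_into U \<phi> z) i))"

definition smooth_on :: "'m manifold \<Rightarrow> 'm set \<Rightarrow> ('m \<Rightarrow> real) \<Rightarrow> bool" where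
  "smooth_on M W f \<longleftrightarrow>
     (\<forall>(U, \<phi>)\<in>charts M. Cinf_on (mdim M) (\<phi> ` (U \<inter> W)) (\<lambda>z. f (inv_into U \<phi> z)))"

abbreviation smooth_functions :: "'m manifold \<Rightarrow> ('m \<Rightarrow> real) set" where
  "smooth_functions M \<equiv> {f. smooth_on M UNIV f}"


section \<open>Smooth vector bundles\<close>

text \<open>
  The total space is the disjoint union of the fibres, which are subspaces of some (possibly
  infinite-dimensional) real vector space \<open>'v\<close> carrying no topology of its own. The smooth structure
  is given by local trivialisations, in the form of local frames \<open>(U, e)\<close>: at every point
  \<open>x \<in> U\<close>, \<open>e 0 x, \<dots>, e (r - 1) x\<close> is a basis of the fibre, where \<open>r\<close> is the rank.
\<close>

record ('m, 'v) vbundle =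
  rank :: nat
  fibre :: "'m \<Rightarrow> 'v set"
  frames :: "('m set \<times> (nat \<Rightarrow> 'm \<Rightarrow> 'v)) set"

definition vector_bundle ::
    "'m::{t2_space,second_countable_topology} manifold \<Rightarrow> ('m, 'v::real_vector) vbundle \<Rightarrow> bool" where
  "vector_bundle M E \<longleftrightarrow>
     (\<forall>x. subspace (fibre E x)) \<and>
     (\<Union>(U, e)\<in>frames E. U) = UNIV \<and>
     (\<forall>(U, e)\<in>frames E. open U \<and>
        (\<forall>x\<in>U. inj_on (\<lambda>i. e i x) {..<rank E} \<and>
               independent ((\<lambda>i. e i x) ` {..<rank E}) \<and>
               span ((\<lambda>i. e i x) ` {..<rank E}) = fibre E x)) \<and>
     (\<forall>(U, e)\<in>frames E. \<forall>(V, e')\<in>frames E.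
        \<exists>h. (\<forall>i<rank E. \<forall>j<rank E. smooth_on M (U \<inter> V) (h i j)) \<and>
            (\<forall>x\<in>U \<inter> V. \<forall>j<rank E. e j x = (\<Sum>i<rank E. h i j x *\<^sub>R e' i x)))"

definition sections :: "'m manifold \<Rightarrow> ('m, 'v::real_vector) vbundle \<Rightarrow> ('m \<Rightarrow> 'v) set" where
  "sections M E =
     {X. (\<forall>x. X x \<in> fibre E x) \<and>
         (\<forall>(U, e)\<in>frames E. \<exists>c. (\<forall>i<rank E. smooth_on M U (c i)) \<and>
            (\<forall>x\<in>U. X x = (\<Sum>i<rank E. c i x *\<^sub>R e i x)))}"

text \<open>
  A bundle map over the identity is a family of linear maps between the fibres, given in local
  frames by matrices of smooth functions. Its values outside the fibres are irrelevant.
\<close>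

definition bundle_map ::
    "'m manifold \<Rightarrow> ('m, 'v::real_vector) vbundle \<Rightarrow> ('m, 'w::real_vector) vbundle \<Rightarrow>
     ('m \<Rightarrow> 'v \<Rightarrow> 'w) \<Rightarrow> bool" where
  "bundle_map M E F A \<longleftrightarrow>
     (\<forall>x. \<forall>u\<in>fibre E x. A x u \<in> fibre F x) \<and>
     (\<forall>x. \<forall>u\<in>fibre E x. \<forall>v\<in>fibre E x. A x (u + v) = A x u + A x v) \<and>
     (\<forall>x c. \<forall>u\<in>fibre E x. A x (c *\<^sub>R u) = c *\<^sub>R A x u) \<and>
     (\<forall>(U, e)\<in>frames E. \<forall>(V, f)\<in>frames F.
        \<exists>a. (\<forall>i<rank F. \<forall>j<rank E. smooth_on M (U \<inter> V) (a i j)) \<and>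
            (\<forall>x\<in>U \<inter> V. \<forall>j<rank E. A x (e j x) = (\<Sum>i<rank F. a i j x *\<^sub>R f i x)))"

abbreviation tensor11 :: "'m manifold \<Rightarrow> ('m, 'v::real_vector) vbundle \<Rightarrow> ('m \<Rightarrow> 'v \<Rightarrow> 'v) \<Rightarrow> bool" where
  "tensor11 M E J \<equiv> bundle_map M E E J"

definition on_section :: "('m \<Rightarrow> 'v \<Rightarrow> 'w) \<Rightarrow> ('m \<Rightarrow> 'v) \<Rightarrow> 'm \<Rightarrow> 'w" where
  "on_section A X = (\<lambda>x. A x (X x))"

definition bcomp :: "('m \<Rightarrow> 'v \<Rightarrow> 'w) \<Rightarrow> ('m \<Rightarrow> 'u \<Rightarrow> 'v) \<Rightarrow> 'm \<Rightarrow> 'u \<Rightarrow> 'w" (infixl "\<circ>\<^sub>b" 55) where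
  "A \<circ>\<^sub>b B = (\<lambda>x. A x \<circ> B x)"

definition bpow :: "('m \<Rightarrow> 'v \<Rightarrow> 'v) \<Rightarrow> nat \<Rightarrow> 'm \<Rightarrow> 'v \<Rightarrow> 'v" where
  "bpow A n = (\<lambda>x. A x ^^ n)"


section \<open>The tangent bundle\<close>

text \<open>
  Tangent vectors at \<open>x\<close> are the derivations at \<open>x\<close> of the algebra of smooth functions. They are
  set to \<open>0\<close> on non-smooth functions, so that equality of tangent vectors is equality in HOL.
\<close>

definition tangent_space :: "'m manifold \<Rightarrow> 'm \<Rightarrow> (('m \<Rightarrow> real) \<Rightarrow> real) set" where
  "tangent_space M x =
     {D. (\<forall>f\<in>smooth_functions M. \<forall>g\<in>smooth_functions M. D (\<lambda>y. f y + g y) = D f + D g) \<and>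
         (\<forall>c. \<forall>f\<in>smooth_functions M. D (\<lambda>y. c * f y) = c * D f) \<and>
         (\<forall>f\<in>smooth_functions M. \<forall>g\<in>smooth_functions M.
            D (\<lambda>y. f y * g y) = f x * D g + g x * D f) \<and>
         (\<forall>f. f \<notin> smooth_functions M \<longrightarrow> D f = 0)}"

definition coord_vector ::
    "'m manifold \<Rightarrow> 'm set \<Rightarrow> ('m \<Rightarrow> nat \<Rightarrow> real) \<Rightarrow> nat \<Rightarrow> 'm \<Rightarrow> ('m \<Rightarrow> real) \<Rightarrow> real" where
  "coord_vector M U \<phi> i x f =
     (if f \<in> smooth_functions M then partial_deriv i (\<lambda>z. f (inv_into U \<phi> z)) (\<phi> x) else 0)"

definition tangent_bundle :: "'m manifold \<Rightarrow> ('m, ('m \<Rightarrow> real) \<Rightarrow> real) vbundle" where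
  "tangent_bundle M =
     \<lparr> rank = mdim M, fibre = tangent_space M,
       frames = (\<lambda>(U, \<phi>). (U, coord_vector M U \<phi>)) ` charts M \<rparr>"


section \<open>Fibrewise metrics and pre-Courant structures\<close>

text \<open>The form \<open>\<langle>\<cdot>,\<cdot>\<rangle>\<close> varies smoothly with the base point; it may be indefinite.\<close>

definition fibre_metric ::
    "'m manifold \<Rightarrow> ('m, 'v::real_vector) vbundle \<Rightarrow> ('m \<Rightarrow> 'v \<Rightarrow> 'v \<Rightarrow> real) \<Rightarrow> bool" where
  "fibre_metric M E g \<longleftrightarrow>
     (\<forall>x. \<forall>u\<in>fibre E x. \<forall>v\<in>fibre E x. \<forall>w\<in>fibre E x. g x (u + v) w = g x u w + g x v w) \<and>
     (\<forall>x c. \<forall>u\<in>fibre E x. \<forall>w\<in>fibre E x. g x (c *\<^sub>R u) w = c * g x u w) \<and>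
     (\<forall>x. \<forall>u\<in>fibre E x. \<forall>v\<in>fibre E x. g x u v = g x v u) \<and>
     (\<forall>x. \<forall>u\<in>fibre E x. (\<forall>v\<in>fibre E x. g x u v = 0) \<longrightarrow> u = 0) \<and>
     (\<forall>(U, e)\<in>frames E. \<forall>i<rank E. \<forall>j<rank E. smooth_on M U (\<lambda>x. g x (e i x) (e j x)))"

definition pairing :: "('m \<Rightarrow> 'v \<Rightarrow> 'v \<Rightarrow> real) \<Rightarrow> ('m \<Rightarrow> 'v) \<Rightarrow> ('m \<Rightarrow> 'v) \<Rightarrow> 'm \<Rightarrow> real" where
  "pairing g X Y = (\<lambda>x. g x (X x) (Y x))"

text \<open>
  A structure is a pair of an anchor and a bracket; only the restriction of the anchor to the
  fibres and that of the bracket to \<^const>\<open>sections\<close> are meaningful. Sums of structures are the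
  (componentwise, pointwise) sums provided by the type classes.
\<close>

type_synonym ('m, 'v) anchor = "'m \<Rightarrow> 'v \<Rightarrow> ('m \<Rightarrow> real) \<Rightarrow> real"
type_synonym ('m, 'v) bracket = "('m \<Rightarrow> 'v) \<Rightarrow> ('m \<Rightarrow> 'v) \<Rightarrow> 'm \<Rightarrow> 'v"
type_synonym ('m, 'v) struct = "('m, 'v) anchor \<times> ('m, 'v) bracket"

definition lie_deriv :: "('m, 'v) anchor \<Rightarrow> ('m \<Rightarrow> 'v) \<Rightarrow> ('m \<Rightarrow> real) \<Rightarrow> 'm \<Rightarrow> real" where
  "lie_deriv \<rho> X f = (\<lambda>x. \<rho> x (X x) f)"

definition pre_courant ::
    "'m manifold \<Rightarrow> ('m, 'v::real_vector) vbundle \<Rightarrow> ('m \<Rightarrow> 'v \<Rightarrow> 'v \<Rightarrow> real) \<Rightarrow>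
     ('m, 'v) struct \<Rightarrow> bool" where
  "pre_courant M E g \<Theta> \<longleftrightarrow> (case \<Theta> of (\<rho>, br) \<Rightarrow>
     bundle_map M E (tangent_bundle M) \<rho> \<and>
     (\<forall>X\<in>sections M E. \<forall>Y\<in>sections M E. br X Y \<in> sections M E) \<and>
     (\<forall>X\<in>sections M E. \<forall>Y\<in>sections M E. \<forall>Z\<in>sections M E.
        br (X + Y) Z = br X Z + br Y Z \<and> br X (Y + Z) = br X Y + br X Z) \<and>
     (\<forall>c. \<forall>X\<in>sections M E. \<forall>Y\<in>sections M E.
        br (c *\<^sub>R X) Y = c *\<^sub>R br X Y \<and> br X (c *\<^sub>R Y) = c *\<^sub>R br X Y) \<and>
     (\<forall>X\<in>sections M E. \<forall>Y\<in>sections M E. \<forall>Z\<in>sections M E.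
        lie_deriv \<rho> X (pairing g Y Z) = pairing g (br X Y) Z + pairing g Y (br X Z)) \<and>
     (\<forall>X\<in>sections M E. \<forall>Y\<in>sections M E. \<forall>Z\<in>sections M E.
        lie_deriv \<rho> X (pairing g Y Z) = pairing g X (br Y Z + br Z Y)))"

definition pre_courant_algebroid ::
    "'m::{t2_space,second_countable_topology} manifold \<Rightarrow> ('m, 'v::real_vector) vbundle \<Rightarrow>
     ('m \<Rightarrow> 'v \<Rightarrow> 'v \<Rightarrow> real) \<Rightarrow> ('m, 'v) struct \<Rightarrow> bool" where
  "pre_courant_algebroid M E g \<Theta> \<longleftrightarrow>
     smooth_manifold M \<and> vector_bundle M E \<and> fibre_metric M E g \<and> pre_courant M E g \<Theta>"


section \<open>Deformed structures and Nijenhuis pairs\<close>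

definition skew_tensor11 ::
    "'m manifold \<Rightarrow> ('m, 'v::real_vector) vbundle \<Rightarrow> ('m \<Rightarrow> 'v \<Rightarrow> 'v \<Rightarrow> real) \<Rightarrow>
     ('m \<Rightarrow> 'v \<Rightarrow> 'v) \<Rightarrow> bool" where
  "skew_tensor11 M E g J \<longleftrightarrow> tensor11 M E J \<and>
     (\<forall>x. \<forall>u\<in>fibre E x. \<forall>v\<in>fibre E x. g x (J x u) v + g x u (J x v) = 0)"

definition deform_bracket ::
    "('m, 'v::real_vector) bracket \<Rightarrow> ('m \<Rightarrow> 'v \<Rightarrow> 'v) \<Rightarrow> ('m, 'v) bracket" where
  "deform_bracket br J X Y =
     br (on_section J X) Y + br X (on_section J Y) - on_section J (br X Y)"

definition deform :: "('m, 'v::real_vector) struct \<Rightarrow> ('m \<Rightarrow> 'v \<Rightarrow> 'v) \<Rightarrow> ('m, 'v) struct" where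
  "deform \<Theta> J = (fst \<Theta> \<circ>\<^sub>b J, deform_bracket (snd \<Theta>) J)"

text \<open>\<open>deforms \<Theta> [T\<^sub>1, \<dots>, T\<^sub>s]\<close> is \<open>((\<Theta>\<^bsub>T\<^sub>1\<^esub>)\<^bsub>T\<^sub>2\<^esub>\<dots>)\<^bsub>T\<^sub>s\<^esub>\<close>.\<close>

definition deforms :: "('m, 'v::real_vector) struct \<Rightarrow> ('m \<Rightarrow> 'v \<Rightarrow> 'v) list \<Rightarrow> ('m, 'v) struct" where
  "deforms \<Theta> Ts = foldl deform \<Theta> Ts"

definition concomitant ::
    "('m, 'v::real_vector) struct \<Rightarrow> ('m \<Rightarrow> 'v \<Rightarrow> 'v) \<Rightarrow> ('m \<Rightarrow> 'v \<Rightarrow> 'v) \<Rightarrow> ('m, 'v) struct" where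
  "concomitant \<Theta> I J = deforms \<Theta> [I, J] + deforms \<Theta> [J, I]"

definition vanishes :: "'m manifold \<Rightarrow> ('m, 'v::real_vector) vbundle \<Rightarrow> ('m, 'v) struct \<Rightarrow> bool" where
  "vanishes M E \<Theta> \<longleftrightarrow>
     (\<forall>x. \<forall>u\<in>fibre E x. fst \<Theta> x u = 0) \<and>
     (\<forall>X\<in>sections M E. \<forall>Y\<in>sections M E. snd \<Theta> X Y = 0)"

definition nijenhuis ::
    "'m manifold \<Rightarrow> ('m, 'v::real_vector) vbundle \<Rightarrow> ('m, 'v) struct \<Rightarrow> ('m \<Rightarrow> 'v \<Rightarrow> 'v) \<Rightarrow> bool" where
  "nijenhuis M E \<Theta> I \<longleftrightarrow>
     (\<forall>X\<in>sections M E. \<forall>Y\<in>sections M E.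
        snd \<Theta> (on_section I X) (on_section I Y) - on_section I (snd (deform \<Theta> I) X Y) = 0)"

definition compatible_pair ::
    "'m manifold \<Rightarrow> ('m, 'v::real_vector) vbundle \<Rightarrow> ('m \<Rightarrow> 'v \<Rightarrow> 'v \<Rightarrow> real) \<Rightarrow>
     ('m, 'v) struct \<Rightarrow> ('m \<Rightarrow> 'v \<Rightarrow> 'v) \<Rightarrow> ('m \<Rightarrow> 'v \<Rightarrow> 'v) \<Rightarrow> bool" where
  "compatible_pair M E g \<Theta> I J \<longleftrightarrow>
     skew_tensor11 M E g I \<and> skew_tensor11 M E g J \<and>
     (\<forall>x. \<forall>u\<in>fibre E x. (I \<circ>\<^sub>b J) x u = - (J \<circ>\<^sub>b I) x u) \<and>
     vanishes M E (concomitant \<Theta> I J)"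

definition nijenhuis_pair ::
    "'m manifold \<Rightarrow> ('m, 'v::real_vector) vbundle \<Rightarrow> ('m \<Rightarrow> 'v \<Rightarrow> 'v \<Rightarrow> real) \<Rightarrow>
     ('m, 'v) struct \<Rightarrow> ('m \<Rightarrow> 'v \<Rightarrow> 'v) \<Rightarrow> ('m \<Rightarrow> 'v \<Rightarrow> 'v) \<Rightarrow> bool" where
  "nijenhuis_pair M E g \<Theta> I J \<longleftrightarrow>
     skew_tensor11 M E g I \<and> skew_tensor11 M E g J \<and>
     compatible_pair M E g \<Theta> I J \<and> nijenhuis M E \<Theta> I \<and> nijenhuis M E \<Theta> J"



section \<open>Calculus of smooth functions\<close>


lemma eventually_fun_upd_in:
  assumes "openin (Euclidean_space n) S" "x \<in> S" "i < n"
  shows "\<forall>\<^sub>F t in nhds (x i). x(i := t) \<in> S"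
proof -
  have S: "S \<subseteq> topspace (Euclidean_space n)" using assms(1) openin_subset by blast
  have "continuous_map euclideanreal (powertop_real UNIV) (\<lambda>t. x(i := t))"
    by (auto simp: continuous_map_componentwise_UNIV fun_upd_def)
  moreover have "x(i := t) \<in> {x. \<forall>i\<ge>n. x i = 0}" for t
    using S assms by (auto simp: topspace_Euclidean_space)
  ultimately have "continuous_map euclideanreal (Euclidean_space n) (\<lambda>t. x(i := t))"
    unfolding Euclidean_space_def by (auto simp: continuous_map_in_subtopology)
  from openin_continuous_map_preimage[OF this assms(1)]
  have "open {t. x(i := t) \<in> S}" by simp
  then show ?thesis using assms(2) by (auto simp: eventually_nhds intro!: exI[of _ "{t. x(i := t) \<in> S}"])
qed

lemma has_partial_cong:
  assumes "openin (Euclidean_space n) S" "x \<in> S" "i < n" "\<And>y. y \<in> S \<Longrightarrow> f y = h y"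
  shows "((\<lambda>t. f (x(i := t))) field_differentiable at (x i)) =
         ((\<lambda>t. h (x(i := t))) field_differentiable at (x i))"
    and "partial_deriv i f x = partial_deriv i h x"
proof -
  have ev: "\<forall>\<^sub>F t in nhds (x i). f (x(i := t)) = h (x(i := t))"
    using eventually_fun_upd_in[OF assms(1-3)] by eventually_elim (use assms(4) in auto)
  show "((\<lambda>t. f (x(i := t))) field_differentiable at (x i)) =
         ((\<lambda>t. h (x(i := t))) field_differentiable at (x i))"
    unfolding field_differentiable_def using DERIV_cong_ev[OF refl ev refl] by blast
  show "partial_deriv i f x = partial_deriv i h x"
    unfolding partial_deriv_def by (rule deriv_cong_ev[OF ev refl])
qed

lemma Ck_on_cong:
  assumes "openin (Euclidean_space n) S" "\<And>y. y \<in> S \<Longrightarrow> f y = h y" "Ck_on n k S f"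
  shows "Ck_on n k S h"
  using assms(2,3)
proof (induction k arbitrary: f h)
  case 0 then show ?case
    by (auto intro: continuous_map_eq)
next
  case (Suc k)
  have "continuous_map (subtopology (Euclidean_space n) S) euclideanreal h"
    using Suc.prems by (auto intro: continuous_map_eq)
  moreover have "Ck_on n k S (partial_deriv i h)" if "i < n" for i
  proof (rule Suc.IH)
    show "Ck_on n k S (partial_deriv i f)" using Suc.prems(2) that by simp
    show "partial_deriv i f y = partial_deriv i h y" if "y \<in> S" for y
      by (rule has_partial_cong(2)[OF assms(1) that \<open>i < n\<close> Suc.prems(1)])
  qed
  moreover have "(\<lambda>t. h (x(i := t))) field_differentiable at (x i)" if "i < n" "x \<in> S" for i x
  proof -
    have "(\<lambda>t. f (x(i := t))) field_differentiable at (x i)" using Suc.prems(2) that by simp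
    then show ?thesis using has_partial_cong(1)[where f = f and h = h, OF assms(1) that(2,1) Suc.prems(1)] by simp
  qed
  ultimately show ?case by simp
qed

lemma Ck_on_SucD: "Ck_on n (Suc k) S f \<Longrightarrow> Ck_on n k S f"
  by (induction k arbitrary: f) auto

lemma Ck_on_subset:
  assumes "T \<subseteq> S" shows "Ck_on n k S f \<Longrightarrow> Ck_on n k T f"
proof (induction k arbitrary: f)
  case 0 then show ?case
    by (simp add: continuous_map_from_subtopology_mono[OF _ assms])
next
  case (Suc k) then show ?case using assms
    by (auto simp: continuous_map_from_subtopology_mono[OF _ assms])
qed

lemma Ck_on_const: "Ck_on n k S (\<lambda>_. c)"
proof (induction k arbitrary: c)
  case (Suc k)
  have "partial_deriv i (\<lambda>_. c) = (\<lambda>_. 0)" for i by (simp add: partial_deriv_def fun_eq_iff)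
  then show ?case using Suc by simp
qed simp

lemma Ck_on_add:
  assumes "openin (Euclidean_space n) S"
  shows "Ck_on n k S f \<Longrightarrow> Ck_on n k S h \<Longrightarrow> Ck_on n k S (\<lambda>x. f x + h x)"
proof (induction k arbitrary: f h)
  case 0 then show ?case by (auto intro: continuous_map_add)
next
  case (Suc k)
  have "Ck_on n k S (partial_deriv i (\<lambda>x. f x + h x))" if "i < n" for i
  proof (rule Ck_on_cong[OF assms])
    show "Ck_on n k S (\<lambda>x. partial_deriv i f x + partial_deriv i h x)"
      using Suc that by auto
    show "partial_deriv i f y + partial_deriv i h y = partial_deriv i (\<lambda>x. f x + h x) y" if "y \<in> S" for y
      using Suc.prems \<open>i < n\<close> that by (auto simp: partial_deriv_def)
  qed
  moreover have "(\<lambda>t. f (x(i := t)) + h (x(i := t))) field_differentiable at (x i)" if "i < n" "x \<in> S" for i x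
    using Suc.prems that by (auto intro: field_differentiable_add)
  ultimately show ?case using Suc.prems by (auto intro: continuous_map_add)
qed

lemma Ck_on_mult:
  assumes "openin (Euclidean_space n) S"
  shows "Ck_on n k S f \<Longrightarrow> Ck_on n k S h \<Longrightarrow> Ck_on n k S (\<lambda>x. f x * h x)"
proof (induction k arbitrary: f h)
  case 0 then show ?case by (auto intro: continuous_map_real_mult)
next
  case (Suc k)
  have fh: "Ck_on n k S f" "Ck_on n k S h" using Suc.prems Ck_on_SucD by blast+
  have "Ck_on n k S (partial_deriv i (\<lambda>x. f x * h x))" if "i < n" for i
  proof (rule Ck_on_cong[OF assms])
    show "Ck_on n k S (\<lambda>x. f x * partial_deriv i h x + partial_deriv i f x * h x)"
      by (intro Ck_on_add[OF assms] Suc.IH fh) (use Suc.prems that in auto)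
    show "f y * partial_deriv i h y + partial_deriv i f y * h y = partial_deriv i (\<lambda>x. f x * h x) y" if "y \<in> S" for y
      using Suc.prems \<open>i < n\<close> that by (auto simp: partial_deriv_def)
  qed
  moreover have "(\<lambda>t. f (x(i := t)) * h (x(i := t))) field_differentiable at (x i)" if "i < n" "x \<in> S" for i x
    using Suc.prems that by (auto intro: field_differentiable_mult)
  ultimately show ?case using Suc.prems by (auto intro: continuous_map_real_mult)
qed

lemma open_chart_image:
  assumes "smooth_manifold M" "(U, \<phi>) \<in> charts M" "open W"
  shows "openin (Euclidean_space (mdim M)) (\<phi> ` (U \<inter> W))"
proof -
  have U: "open U" and op: "openin (Euclidean_space (mdim M)) (\<phi> ` U)"
    and h: "homeomorphic_map (subtopology euclidean U) (subtopology (Euclidean_space (mdim M)) (\<phi> ` U)) \<phi>"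
    using assms unfolding smooth_manifold_def by auto
  have "openin (subtopology euclidean U) (U \<inter> W)"
    using assms(3) by (simp add: openin_open_Int)
  then have "openin (subtopology (Euclidean_space (mdim M)) (\<phi> ` U)) (\<phi> ` (U \<inter> W))"
    using homeomorphic_imp_open_map[OF h] unfolding open_map_def by blast
  then show ?thesis using openin_trans_full op by blast
qed

lemma smooth_onI:
  "(\<And>U \<phi> k. (U, \<phi>) \<in> charts M \<Longrightarrow> Ck_on (mdim M) k (\<phi> ` (U \<inter> W)) (\<lambda>z. f (inv_into U \<phi> z))) \<Longrightarrow> smooth_on M W f"
  by (simp add: smooth_on_def Cinf_on_def split_beta)

lemma smooth_onD:
  assumes "smooth_on M W f" "(U, \<phi>) \<in> charts M"
  shows "Ck_on (mdim M) k (\<phi> ` (U \<inter> W)) (\<lambda>z. f (inv_into U \<phi> z))"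
  using bspec[OF assms(1)[unfolded smooth_on_def] assms(2)] by (simp add: Cinf_on_def)

lemma smooth_on_subset: "smooth_on M W f \<Longrightarrow> V \<subseteq> W \<Longrightarrow> smooth_on M V f"
proof (rule smooth_onI)
  fix U \<phi> k assume a: "smooth_on M W f" "V \<subseteq> W" "(U, \<phi>) \<in> charts M"
  have "\<phi> ` (U \<inter> V) \<subseteq> \<phi> ` (U \<inter> W)" using a(2) by blast
  then show "Ck_on (mdim M) k (\<phi> ` (U \<inter> V)) (\<lambda>z. f (inv_into U \<phi> z))"
    using smooth_onD[OF a(1,3)] Ck_on_subset by blast
qed

lemma smooth_on_cong:
  assumes "smooth_manifold M" "open W" "smooth_on M W f" "\<And>x. x \<in> W \<Longrightarrow> f x = h x"
  shows "smooth_on M W h"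
proof (rule smooth_onI)
  fix U \<phi> k assume c: "(U, \<phi>) \<in> charts M"
  have inj: "inj_on \<phi> U"
  proof -
    have "homeomorphic_map (subtopology euclidean U) (subtopology (Euclidean_space (mdim M)) (\<phi> ` U)) \<phi>"
      using assms(1) c unfolding smooth_manifold_def by fast
    from homeomorphic_imp_injective_map[OF this] show ?thesis by simp
  qed
  show "Ck_on (mdim M) k (\<phi> ` (U \<inter> W)) (\<lambda>z. h (inv_into U \<phi> z))"
  proof (rule Ck_on_cong)
    show "openin (Euclidean_space (mdim M)) (\<phi> ` (U \<inter> W))" using open_chart_image assms c by blast
    show "Ck_on (mdim M) k (\<phi> ` (U \<inter> W)) (\<lambda>z. f (inv_into U \<phi> z))"
      by (rule smooth_onD[OF assms(3) c])
    show "f (inv_into U \<phi> y) = h (inv_into U \<phi> y)" if "y \<in> \<phi> ` (U \<inter> W)" for y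
      using that assms(4) inj by auto
  qed
qed

lemma smooth_on_const: "smooth_on M W (\<lambda>_. c)"
  by (intro smooth_onI Ck_on_const)

lemma smooth_on_add:
  assumes "smooth_manifold M" "open W" "smooth_on M W f" "smooth_on M W h"
  shows "smooth_on M W (\<lambda>x. f x + h x)"
  by (rule smooth_onI) (intro Ck_on_add open_chart_image[OF assms(1)] smooth_onD[OF assms(3)] smooth_onD[OF assms(4)] assms(2))

lemma smooth_on_mult:
  assumes "smooth_manifold M" "open W" "smooth_on M W f" "smooth_on M W h"
  shows "smooth_on M W (\<lambda>x. f x * h x)"
  by (rule smooth_onI) (intro Ck_on_mult open_chart_image[OF assms(1)] smooth_onD[OF assms(3)] smooth_onD[OF assms(4)] assms(2))

lemma smooth_on_sum:
  assumes "smooth_manifold M" "open W" "\<And>i. i < (n::nat) \<Longrightarrow> smooth_on M W (f i)"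
  shows "smooth_on M W (\<lambda>x. \<Sum>i<n. f i x)"
  using assms(3)
proof (induction n)
  case 0 then show ?case by (simp add: smooth_on_const)
next
  case (Suc n) then show ?case by (simp add: smooth_on_add[OF assms(1,2)])
qed

lemma Ck_on_local:
  assumes "openin (Euclidean_space n) S"
    "\<And>x. x \<in> S \<Longrightarrow> \<exists>T. openin (Euclidean_space n) T \<and> x \<in> T \<and> T \<subseteq> S \<and> Ck_on n k T f"
  shows "Ck_on n k S f"
  using assms(2)
proof (induction k arbitrary: f)
  case 0
  obtain T where T: "\<And>x. x \<in> S \<Longrightarrow> openin (Euclidean_space n) (T x) \<and> x \<in> T x \<and> T x \<subseteq> S \<and> Ck_on n 0 (T x) f"
    using 0 by metis
  have S: "S \<subseteq> topspace (Euclidean_space n)" using assms(1) openin_subset by blast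
  have "continuous_map (subtopology (Euclidean_space n) S) euclideanreal f"
  proof (rule pasting_lemma[where I = S and T = T and f = "\<lambda>_. f"])
    show "openin (subtopology (Euclidean_space n) S) (T i)" if "i \<in> S" for i
      using T[OF that] by (metis inf.absorb_iff2 openin_subtopology_Int2)
    show "continuous_map (subtopology (subtopology (Euclidean_space n) S) (T i)) euclideanreal f" if "i \<in> S" for i
      using T[OF that] by (simp add: subtopology_subtopology inf.absorb2)
  qed (use T S in auto)
  then show ?case by simp
next
  case (Suc k)
  have "Ck_on n 0 S f"
  proof -
    have "Ck_on n k S f"
    proof (rule Suc.IH)
      fix x assume "x \<in> S"
      from Suc.prems[OF this] obtain T where "openin (Euclidean_space n) T" "x \<in> T" "T \<subseteq> S" "Ck_on n (Suc k) T f"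
        by blast
      then show "\<exists>T. openin (Euclidean_space n) T \<and> x \<in> T \<and> T \<subseteq> S \<and> Ck_on n k T f"
        using Ck_on_SucD by (intro exI[of _ T]) simp
    qed
    then show ?thesis by (cases k) auto
  qed
  moreover have "Ck_on n k S (partial_deriv i f)" if "i < n" for i
  proof (rule Suc.IH)
    fix x assume "x \<in> S"
    from Suc.prems[OF this] obtain T where "openin (Euclidean_space n) T" "x \<in> T" "T \<subseteq> S" "Ck_on n (Suc k) T f"
      by blast
    then show "\<exists>T. openin (Euclidean_space n) T \<and> x \<in> T \<and> T \<subseteq> S \<and> Ck_on n k T (partial_deriv i f)"
      using that by (intro exI[of _ T]) simp
  qed
  moreover have "(\<lambda>t. f (x(i := t))) field_differentiable at (x i)" if "i < n" "x \<in> S" for i x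
  proof -
    from Suc.prems[OF that(2)] obtain T where "x \<in> T" "Ck_on n (Suc k) T f" by blast
    then show ?thesis using that(1) by simp
  qed
  ultimately show ?case by simp
qed

lemma smooth_on_local:
  assumes M: "smooth_manifold M" and "open W"
    and cov: "\<And>x. x \<in> W \<Longrightarrow> \<exists>V. open V \<and> x \<in> V \<and> V \<subseteq> W \<and> smooth_on M V f"
  shows "smooth_on M W f"
proof (rule smooth_onI)
  fix U \<phi> k assume c: "(U, \<phi>) \<in> charts M"
  show "Ck_on (mdim M) k (\<phi> ` (U \<inter> W)) (\<lambda>z. f (inv_into U \<phi> z))"
  proof (rule Ck_on_local)
    show "openin (Euclidean_space (mdim M)) (\<phi> ` (U \<inter> W))" using open_chart_image assms c by blast
    fix z assume "z \<in> \<phi> ` (U \<inter> W)"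
    then obtain x where x: "x \<in> U" "x \<in> W" "z = \<phi> x" by auto
    then obtain V where V: "open V" "x \<in> V" "V \<subseteq> W" "smooth_on M V f" using cov by blast
    show "\<exists>T. openin (Euclidean_space (mdim M)) T \<and> z \<in> T \<and> T \<subseteq> \<phi> ` (U \<inter> W) \<and>
              Ck_on (mdim M) k T (\<lambda>z. f (inv_into U \<phi> z))"
    proof (intro exI conjI)
      show "openin (Euclidean_space (mdim M)) (\<phi> ` (U \<inter> V))" using open_chart_image M V c by blast
      show "z \<in> \<phi> ` (U \<inter> V)" using x V by auto
      show "\<phi> ` (U \<inter> V) \<subseteq> \<phi> ` (U \<inter> W)" using V by auto
      show "Ck_on (mdim M) k (\<phi> ` (U \<inter> V)) (\<lambda>z. f (inv_into U \<phi> z))"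
        by (rule smooth_onD[OF V(4) c])
    qed
  qed
qed

section \<open>Operations on sections and bundle maps\<close>

lemma bundle_map_sum:
  assumes A: "bundle_map M E F A" and E: "\<And>x. subspace (fibre E x)" and F: "\<And>x. subspace (fibre F x)"
    and u: "\<And>i. i < n \<Longrightarrow> u i \<in> fibre E x"
  shows "A x (\<Sum>i<(n::nat). c i *\<^sub>R u i) = (\<Sum>i<n. c i *\<^sub>R A x (u i))"
  using u
proof (induction n)
  case 0
  have "A x (0 *\<^sub>R 0) = 0 *\<^sub>R A x 0"
    using A subspace_0[OF E] unfolding bundle_map_def by blast
  then show ?case by simp
next
  case (Suc n)
  have "(\<Sum>i<n. c i *\<^sub>R u i) \<in> fibre E x" "c n *\<^sub>R u n \<in> fibre E x" "u n \<in> fibre E x"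
    using Suc.prems by (auto intro!: subspace_sum subspace_scale E)
  then show ?case using Suc A unfolding bundle_map_def by simp
qed

lemma vector_bundleD:
  assumes "vector_bundle M E"
  shows fibre_subspace: "subspace (fibre E x)"
    and frames_cover: "\<exists>U e. (U, e) \<in> frames E \<and> x \<in> U"
    and frame_open: "(U, e) \<in> frames E \<Longrightarrow> open U"
    and frame_span: "(U, e) \<in> frames E \<Longrightarrow> x \<in> U \<Longrightarrow> span ((\<lambda>i. e i x) ` {..<rank E}) = fibre E x"
proof -
  note D = assms[unfolded vector_bundle_def]
  show "subspace (fibre E x)" using D[THEN conjunct1] by blast
  have "x \<in> (\<Union>(U, e)\<in>frames E. U)" using D[THEN conjunct2, THEN conjunct1] by simp
  then show "\<exists>U e. (U, e) \<in> frames E \<and> x \<in> U" by blast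
  note F = D[THEN conjunct2, THEN conjunct2, THEN conjunct1]
  show "open U" if "(U, e) \<in> frames E" using bspec[OF F that] by simp
  show "span ((\<lambda>i. e i x) ` {..<rank E}) = fibre E x" if "(U, e) \<in> frames E" "x \<in> U"
    using bspec[OF F that(1)] that(2) by simp
qed

lemma frame_in_fibre:
  assumes "vector_bundle M E" "(U, e) \<in> frames E" "x \<in> U" "i < rank E"
  shows "e i x \<in> fibre E x"
proof -
  have "e i x \<in> span ((\<lambda>i. e i x) ` {..<rank E})" using assms(4) by (intro span_base) auto
  then show ?thesis by (simp add: frame_span[OF assms(1-3)])
qed

lemma on_section_in_sections:
  assumes M: "smooth_manifold M" and E: "vector_bundle M E" and J: "tensor11 M E J" and X: "X \<in> sections M E"
  shows "on_section J X \<in> sections M E"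
  unfolding sections_def
proof (safe)
  fix x show "on_section J X x \<in> fibre E x"
    using X J unfolding sections_def bundle_map_def on_section_def by auto
next
  fix U e assume e: "(U, e) \<in> frames E"
  obtain c where c: "\<And>i. i < rank E \<Longrightarrow> smooth_on M U (c i)" "\<And>x. x \<in> U \<Longrightarrow> X x = (\<Sum>i<rank E. c i x *\<^sub>R e i x)"
    using X e unfolding sections_def by fast
  have "\<exists>a. (\<forall>i<rank E. \<forall>j<rank E. smooth_on M (U \<inter> U) (a i j)) \<and>
            (\<forall>x\<in>U \<inter> U. \<forall>j<rank E. J x (e j x) = (\<Sum>i<rank E. a i j x *\<^sub>R e i x))"
    using J e unfolding bundle_map_def by blast
  then obtain a where a: "\<And>i j. i < rank E \<Longrightarrow> j < rank E \<Longrightarrow> smooth_on M U (a i j)"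
      "\<And>x j. x \<in> U \<Longrightarrow> j < rank E \<Longrightarrow> J x (e j x) = (\<Sum>i<rank E. a i j x *\<^sub>R e i x)"
    unfolding Int_absorb by blast
  show "\<exists>c. (\<forall>i<rank E. smooth_on M U (c i)) \<and>
            (\<forall>x\<in>U. on_section J X x = (\<Sum>i<rank E. c i x *\<^sub>R e i x))"
  proof (intro exI[of _ "\<lambda>i x. \<Sum>j<rank E. c j x * a i j x"] conjI allI impI ballI)
    fix i assume "i < rank E"
    then show "smooth_on M U (\<lambda>x. \<Sum>j<rank E. c j x * a i j x)"
      by (intro smooth_on_sum smooth_on_mult M frame_open[OF E e] c a)
  next
    fix x assume x: "x \<in> U"
    have "on_section J X x = (\<Sum>j<rank E. c j x *\<^sub>R J x (e j x))"
      unfolding on_section_def c(2)[OF x]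
      by (intro bundle_map_sum[OF J] fibre_subspace[OF E] frame_in_fibre[OF E e x])
    also have "\<dots> = (\<Sum>j<rank E. \<Sum>i<rank E. (c j x * a i j x) *\<^sub>R e i x)"
      by (simp add: a(2)[OF x] scaleR_sum_right)
    also have "\<dots> = (\<Sum>i<rank E. (\<Sum>j<rank E. c j x * a i j x) *\<^sub>R e i x)"
      by (subst sum.swap) (simp add: scaleR_sum_left)
    finally show "on_section J X x = (\<Sum>i<rank E. (\<Sum>j<rank E. c j x * a i j x) *\<^sub>R e i x)" .
  qed
qed

lemma bundle_map_bcomp:
  assumes M: "smooth_manifold M" and E: "vector_bundle M E" and F: "\<And>x. subspace (fibre F x)"
    and oF: "\<And>V f. (V, f) \<in> frames F \<Longrightarrow> open V"
    and J: "tensor11 M E J" and B: "bundle_map M E F B"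
  shows "bundle_map M E F (B \<circ>\<^sub>b J)"
  unfolding bundle_map_def
proof (safe)
  fix U e V f assume e: "(U, e) \<in> frames E" and f: "(V, f) \<in> frames F"
  have "\<exists>a. (\<forall>i<rank E. \<forall>j<rank E. smooth_on M (U \<inter> U) (a i j)) \<and>
            (\<forall>x\<in>U \<inter> U. \<forall>j<rank E. J x (e j x) = (\<Sum>i<rank E. a i j x *\<^sub>R e i x))"
    using J e unfolding bundle_map_def by blast
  then obtain a where a: "\<And>i j. i < rank E \<Longrightarrow> j < rank E \<Longrightarrow> smooth_on M U (a i j)"
      "\<And>x j. x \<in> U \<Longrightarrow> j < rank E \<Longrightarrow> J x (e j x) = (\<Sum>i<rank E. a i j x *\<^sub>R e i x)"
    unfolding Int_absorb by blast
  have "\<exists>a. (\<forall>i<rank F. \<forall>j<rank E. smooth_on M (U \<inter> V) (a i j)) \<and>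
            (\<forall>x\<in>U \<inter> V. \<forall>j<rank E. B x (e j x) = (\<Sum>i<rank F. a i j x *\<^sub>R f i x))"
    using B e f unfolding bundle_map_def by blast
  then obtain b where b: "\<And>i j. i < rank F \<Longrightarrow> j < rank E \<Longrightarrow> smooth_on M (U \<inter> V) (b i j)"
      "\<And>x j. x \<in> U \<inter> V \<Longrightarrow> j < rank E \<Longrightarrow> B x (e j x) = (\<Sum>i<rank F. b i j x *\<^sub>R f i x)"
    by blast
  have o: "open (U \<inter> V)" using frame_open[OF E e] oF[OF f] by blast
  show "\<exists>a. (\<forall>i<rank F. \<forall>j<rank E. smooth_on M (U \<inter> V) (a i j)) \<and>
            (\<forall>x\<in>U \<inter> V. \<forall>j<rank E. (B \<circ>\<^sub>b J) x (e j x) = (\<Sum>i<rank F. a i j x *\<^sub>R f i x))"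
  proof (intro exI[of _ "\<lambda>k j x. \<Sum>i<rank E. a i j x * b k i x"] conjI allI impI ballI)
    fix k j assume "k < rank F" "j < rank E"
    then show "smooth_on M (U \<inter> V) (\<lambda>x. \<Sum>i<rank E. a i j x * b k i x)"
      by (intro smooth_on_sum smooth_on_mult M o b smooth_on_subset[OF a(1)]) auto
  next
    fix x j assume x: "x \<in> U \<inter> V" and j: "j < rank E"
    have xU: "x \<in> U" using x by simp
    have "(B \<circ>\<^sub>b J) x (e j x) = (\<Sum>i<rank E. a i j x *\<^sub>R B x (e i x))"
      unfolding bcomp_def o_def a(2)[OF xU j]
      by (intro bundle_map_sum[OF B] fibre_subspace[OF E] frame_in_fibre[OF E e xU] F)
    also have "\<dots> = (\<Sum>i<rank E. \<Sum>k<rank F. (a i j x * b k i x) *\<^sub>R f k x)"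
      by (simp add: b(2)[OF x] scaleR_sum_right)
    also have "\<dots> = (\<Sum>k<rank F. (\<Sum>i<rank E. a i j x * b k i x) *\<^sub>R f k x)"
      by (subst sum.swap) (simp add: scaleR_sum_left)
    finally show "(B \<circ>\<^sub>b J) x (e j x) = (\<Sum>k<rank F. (\<Sum>i<rank E. a i j x * b k i x) *\<^sub>R f k x)" .
  qed
qed (use J B in \<open>auto simp: bundle_map_def bcomp_def\<close>)

lemma sections_lincomb:
  assumes M: "smooth_manifold M" and E: "vector_bundle M E" and X: "X \<in> sections M E" and Y: "Y \<in> sections M E"
  shows "s *\<^sub>R X + t *\<^sub>R Y \<in> sections M E"
  unfolding sections_def
proof (safe)
  fix x show "(s *\<^sub>R X + t *\<^sub>R Y) x \<in> fibre E x"
    using X Y fibre_subspace[OF E] unfolding sections_def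
    by (auto intro!: subspace_add subspace_scale)
next
  fix U e assume e: "(U, e) \<in> frames E"
  obtain c where c: "\<And>i. i < rank E \<Longrightarrow> smooth_on M U (c i)" "\<And>x. x \<in> U \<Longrightarrow> X x = (\<Sum>i<rank E. c i x *\<^sub>R e i x)"
    using X e unfolding sections_def by fast
  obtain d where d: "\<And>i. i < rank E \<Longrightarrow> smooth_on M U (d i)" "\<And>x. x \<in> U \<Longrightarrow> Y x = (\<Sum>i<rank E. d i x *\<^sub>R e i x)"
    using Y e unfolding sections_def by fast
  show "\<exists>c. (\<forall>i<rank E. smooth_on M U (c i)) \<and>
            (\<forall>x\<in>U. (s *\<^sub>R X + t *\<^sub>R Y) x = (\<Sum>i<rank E. c i x *\<^sub>R e i x))"
  proof (intro exI[of _ "\<lambda>i x. s * c i x + t * d i x"] conjI allI impI ballI)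
    fix i assume "i < rank E"
    then show "smooth_on M U (\<lambda>x. s * c i x + t * d i x)"
      by (intro smooth_on_add smooth_on_mult smooth_on_const M frame_open[OF E e] c(1) d(1))
  next
    fix x assume x: "x \<in> U"
    show "(s *\<^sub>R X + t *\<^sub>R Y) x = (\<Sum>i<rank E. (s * c i x + t * d i x) *\<^sub>R e i x)"
      unfolding plus_fun_apply scaleR_fun_apply c(2)[OF x] d(2)[OF x]
      by (simp add: scaleR_sum_right scaleR_add_left sum.distrib)
  qed
qed

lemma sections_add: "smooth_manifold M \<Longrightarrow> vector_bundle M E \<Longrightarrow> X \<in> sections M E \<Longrightarrow> Y \<in> sections M E \<Longrightarrow> X + Y \<in> sections M E"
  using sections_lincomb[of M E X Y 1 1] by (simp only: scaleR_one)

lemma sections_diff: "smooth_manifold M \<Longrightarrow> vector_bundle M E \<Longrightarrow> X \<in> sections M E \<Longrightarrow> Y \<in> sections M E \<Longrightarrow> X - Y \<in> sections M E"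
  using sections_lincomb[of M E X Y 1 "-1"] by (simp only: scaleR_one scaleR_minus1_left add_uminus_conv_diff)

lemma fibre_metricD:
  assumes "fibre_metric M E g"
  shows "u \<in> fibre E x \<Longrightarrow> v \<in> fibre E x \<Longrightarrow> w \<in> fibre E x \<Longrightarrow> g x (u + v) w = g x u w + g x v w"
    and "u \<in> fibre E x \<Longrightarrow> w \<in> fibre E x \<Longrightarrow> g x (c *\<^sub>R u) w = c * g x u w"
    and "u \<in> fibre E x \<Longrightarrow> v \<in> fibre E x \<Longrightarrow> g x u v = g x v u"
    and "(U, e) \<in> frames E \<Longrightarrow> i < rank E \<Longrightarrow> j < rank E \<Longrightarrow> smooth_on M U (\<lambda>x. g x (e i x) (e j x))"
proof -
  note D = assms[unfolded fibre_metric_def]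
  show "u \<in> fibre E x \<Longrightarrow> v \<in> fibre E x \<Longrightarrow> w \<in> fibre E x \<Longrightarrow> g x (u + v) w = g x u w + g x v w"
    using D[THEN conjunct1] by blast
  show "u \<in> fibre E x \<Longrightarrow> w \<in> fibre E x \<Longrightarrow> g x (c *\<^sub>R u) w = c * g x u w"
    using D[THEN conjunct2, THEN conjunct1] by blast
  show "u \<in> fibre E x \<Longrightarrow> v \<in> fibre E x \<Longrightarrow> g x u v = g x v u"
    using D[THEN conjunct2, THEN conjunct2, THEN conjunct1] by blast
  show "(U, e) \<in> frames E \<Longrightarrow> i < rank E \<Longrightarrow> j < rank E \<Longrightarrow> smooth_on M U (\<lambda>x. g x (e i x) (e j x))"
    using D[THEN conjunct2, THEN conjunct2, THEN conjunct2, THEN conjunct2] by blast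
qed

lemma metric_sum_left:
  assumes g: "fibre_metric M E g" and E: "\<And>x. subspace (fibre E x)"
    and u: "\<And>i. i < n \<Longrightarrow> u i \<in> fibre E x" and w: "w \<in> fibre E x"
  shows "g x (\<Sum>i<(n::nat). c i *\<^sub>R u i) w = (\<Sum>i<n. c i * g x (u i) w)"
  using u
proof (induction n)
  case 0
  have "g x (0 *\<^sub>R 0) w = 0 * g x 0 w"
    by (rule fibre_metricD(2)[OF g subspace_0[OF E] w])
  then show ?case by simp
next
  case (Suc n)
  have "(\<Sum>i<n. c i *\<^sub>R u i) \<in> fibre E x" "c n *\<^sub>R u n \<in> fibre E x" "u n \<in> fibre E x"
    using Suc.prems by (auto intro!: subspace_sum subspace_scale E)
  then show ?case using Suc w by (simp add: fibre_metricD(1,2)[OF g])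
qed

lemma pairing_smooth:
  assumes M: "smooth_manifold M" and E: "vector_bundle M E" and g: "fibre_metric M E g"
    and X: "X \<in> sections M E" and Y: "Y \<in> sections M E"
  shows "pairing g X Y \<in> smooth_functions M"
proof -
  have sym: "g x u v = g x v u" if "u \<in> fibre E x" "v \<in> fibre E x" for x u v
    by (rule fibre_metricD(3)[OF g that])
  have "smooth_on M U (pairing g X Y)" if e: "(U, e) \<in> frames E" for U e
  proof -
    obtain c where c: "\<And>i. i < rank E \<Longrightarrow> smooth_on M U (c i)" "\<And>x. x \<in> U \<Longrightarrow> X x = (\<Sum>i<rank E. c i x *\<^sub>R e i x)"
      using X e unfolding sections_def by fast
    obtain d where d: "\<And>i. i < rank E \<Longrightarrow> smooth_on M U (d i)" "\<And>x. x \<in> U \<Longrightarrow> Y x = (\<Sum>i<rank E. d i x *\<^sub>R e i x)"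
      using Y e unfolding sections_def by fast
    note o = frame_open[OF E e]
    have ge: "smooth_on M U (\<lambda>x. g x (e i x) (e j x))" if "i < rank E" "j < rank E" for i j
      by (rule fibre_metricD(4)[OF g e that])
    show ?thesis
    proof (rule smooth_on_cong[OF M o])
      show "smooth_on M U (\<lambda>x. \<Sum>i<rank E. c i x * (\<Sum>j<rank E. d j x * g x (e j x) (e i x)))"
        by (intro smooth_on_sum smooth_on_mult M o c d ge)
      fix x assume x: "x \<in> U"
      have ei: "e i x \<in> fibre E x" if "i < rank E" for i using frame_in_fibre[OF E e x that] .
      have Yx: "Y x \<in> fibre E x" using Y unfolding sections_def by blast
      have "g x (X x) (Y x) = (\<Sum>i<rank E. c i x * g x (e i x) (Y x))"
        unfolding c(2)[OF x] by (intro metric_sum_left[OF g] fibre_subspace[OF E] ei Yx)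
      also have "\<dots> = (\<Sum>i<rank E. c i x * g x (Y x) (e i x))"
        using sym ei Yx by simp
      also have "\<dots> = (\<Sum>i<rank E. c i x * (\<Sum>j<rank E. d j x * g x (e j x) (e i x)))"
        unfolding d(2)[OF x]
        by (intro sum.cong refl arg_cong[where f = "(*) _"] metric_sum_left[OF g] fibre_subspace[OF E] ei) auto
      finally show "(\<Sum>i<rank E. c i x * (\<Sum>j<rank E. d j x * g x (e j x) (e i x))) = pairing g X Y x"
        unfolding pairing_def by simp
    qed
  qed
  note * = this
  have "smooth_on M UNIV (pairing g X Y)"
  proof (rule smooth_on_local[OF M])
    fix x
    obtain U e where "(U, e) \<in> frames E" "x \<in> U" using frames_cover[OF E] by blast
    then show "\<exists>V. open V \<and> x \<in> V \<and> V \<subseteq> UNIV \<and> smooth_on M V (pairing g X Y)"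
      using * frame_open[OF E] by blast
  qed simp
  then show ?thesis by simp
qed

section \<open>Deformations of pre-Courant structures are pre-Courant structures\<close>

theorem pre_courant_deform:
  assumes "pre_courant_algebroid M E g \<Theta>" and "skew_tensor11 M E g J"
  shows "pre_courant M E g (deform \<Theta> J)"
proof -
  obtain \<rho> br where \<Theta>: "\<Theta> = (\<rho>, br)" by fastforce
  have M: "smooth_manifold M" and E: "vector_bundle M E" and g: "fibre_metric M E g"
    and P: "pre_courant M E g (\<rho>, br)"
    using assms(1) unfolding pre_courant_algebroid_def \<Theta> by auto
  have J: "tensor11 M E J" using assms(2) unfolding skew_tensor11_def by auto
  define J' where "J' = on_section J"
  let ?S = "sections M E"
  have J'S [intro, simp]: "J' X \<in> ?S" if "X \<in> ?S" for X
    using on_section_in_sections[OF M E J that] by (simp add: J'_def)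
  have brS [intro, simp]: "br X Y \<in> ?S" if "X \<in> ?S" "Y \<in> ?S" for X Y using P that unfolding pre_courant_def by auto
  note addS [intro, simp] = sections_add[OF M E] 
  note diffS [intro, simp] = sections_diff[OF M E]
  have scS [intro, simp]: "c *\<^sub>R X \<in> ?S" if "X \<in> ?S" for X c using sections_lincomb[OF M E that that, of c 0] by simp
  have fib [intro, simp]: "X x \<in> fibre E x" if "X \<in> ?S" for X x using that unfolding sections_def by auto
  have J'a: "J' (X + Y) = J' X + J' Y" if "X \<in> ?S" "Y \<in> ?S" for X Y
    using J that unfolding J'_def on_section_def bundle_map_def by (auto simp: fun_eq_iff)
  have J's: "J' (c *\<^sub>R X) = c *\<^sub>R J' X" if "X \<in> ?S" for X c
    using J that unfolding J'_def on_section_def bundle_map_def by (auto simp: fun_eq_iff)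
  have bra: "br (X + Y) Z = br X Z + br Y Z" "br X (Y + Z) = br X Y + br X Z"
    if "X \<in> ?S" "Y \<in> ?S" "Z \<in> ?S" for X Y Z
    using P that unfolding pre_courant_def by auto
  have brs: "br (c *\<^sub>R X) Y = c *\<^sub>R br X Y" "br X (c *\<^sub>R Y) = c *\<^sub>R br X Y"
    if "X \<in> ?S" "Y \<in> ?S" for X Y c
    using P that unfolding pre_courant_def by auto
  have ax1: "lie_deriv \<rho> X (pairing g Y Z) = pairing g (br X Y) Z + pairing g Y (br X Z)"
    if "X \<in> ?S" "Y \<in> ?S" "Z \<in> ?S" for X Y Z
    using P that unfolding pre_courant_def by auto
  have ax2: "lie_deriv \<rho> X (pairing g Y Z) = pairing g X (br Y Z + br Z Y)"
    if "X \<in> ?S" "Y \<in> ?S" "Z \<in> ?S" for X Y Z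
    using P that unfolding pre_courant_def by auto
  have sym: "pairing g X Y = pairing g Y X" if "X \<in> ?S" "Y \<in> ?S" for X Y
    using fibre_metricD(3)[OF g fib[OF that(1)] fib[OF that(2)]] by (simp add: fun_eq_iff pairing_def)
  have pa: "pairing g (X + Y) Z = pairing g X Z + pairing g Y Z" if "X \<in> ?S" "Y \<in> ?S" "Z \<in> ?S" for X Y Z
    using fibre_metricD(1)[OF g fib[OF that(1)] fib[OF that(2)] fib[OF that(3)]] by (simp add: fun_eq_iff pairing_def)
  have pd: "pairing g (X - Y) Z = pairing g X Z - pairing g Y Z" if "X \<in> ?S" "Y \<in> ?S" "Z \<in> ?S" for X Y Z
    using pa[of "X - Y" Y Z] that by simp
  have pa2: "pairing g Z (X + Y) = pairing g Z X + pairing g Z Y" if "X \<in> ?S" "Y \<in> ?S" "Z \<in> ?S" for X Y Z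
    using pa[OF that] sym that by simp
  have pd2: "pairing g Z (X - Y) = pairing g Z X - pairing g Z Y" if "X \<in> ?S" "Y \<in> ?S" "Z \<in> ?S" for X Y Z
    using pd[OF that] sym that by simp
  have skew: "pairing g (J' X) Y = - pairing g X (J' Y)" if "X \<in> ?S" "Y \<in> ?S" for X Y
    using assms(2) that unfolding skew_tensor11_def pairing_def J'_def on_section_def
    by (auto simp: fun_eq_iff eq_neg_iff_add_eq_0)
  have ld0: "lie_deriv \<rho> X (pairing g (J' Y) Z) + lie_deriv \<rho> X (pairing g Y (J' Z)) = 0"
    if "X \<in> ?S" "Y \<in> ?S" "Z \<in> ?S" for X Y Z
  proof -
    let ?f = "pairing g (J' Y) Z" and ?h = "pairing g Y (J' Z)"
    have fh: "?f \<in> smooth_functions M" "?h \<in> smooth_functions M"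
      using that by (auto intro!: pairing_smooth[OF M E g, simplified])
    show ?thesis
    proof
      fix x
      have D: "\<rho> x (X x) \<in> tangent_space M x"
        using P that(1) unfolding pre_courant_def bundle_map_def tangent_bundle_def by simp
      have h: "?f = (\<lambda>y. -1 * ?h y)" using skew[OF that(2,3)] by (simp add: fun_eq_iff)
      have "\<rho> x (X x) (\<lambda>y. -1 * ?h y) = -1 * \<rho> x (X x) ?h"
        using D fh(2) unfolding tangent_space_def by blast
      then show "(lie_deriv \<rho> X ?f + lie_deriv \<rho> X ?h) x = 0 x"
        unfolding lie_deriv_def h[symmetric] by simp
    qed
  qed
  have ldJ: "lie_deriv (\<rho> \<circ>\<^sub>b J) X f = lie_deriv \<rho> (J' X) f" for X f
    by (simp add: lie_deriv_def bcomp_def J'_def on_section_def)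
  have db: "deform_bracket br J X Y = br (J' X) Y + br X (J' Y) - J' (br X Y)" for X Y
    by (simp add: deform_bracket_def J'_def)
  have "bundle_map M E (tangent_bundle M) (\<rho> \<circ>\<^sub>b J)"
  proof (rule bundle_map_bcomp[OF M E _ _ J])
    show "bundle_map M E (tangent_bundle M) \<rho>" using P unfolding pre_courant_def by simp
    show "subspace (fibre (tangent_bundle M) x)" for x
      unfolding subspace_def tangent_bundle_def tangent_space_def by (auto simp: algebra_simps)
    show "open V" if "(V, f) \<in> frames (tangent_bundle M)" for V f
      using that M unfolding tangent_bundle_def smooth_manifold_def by auto
  qed
  moreover have "lie_deriv \<rho> (J' X) (pairing g Y Z) =
      pairing g (br (J' X) Y + br X (J' Y) - J' (br X Y)) Z +
      pairing g Y (br (J' X) Z + br X (J' Z) - J' (br X Z))"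
    if "X \<in> ?S" "Y \<in> ?S" "Z \<in> ?S" for X Y Z
    using ax1[of "J' X" Y Z] ld0[OF that] ax1[of X "J' Y" Z] ax1[of X Y "J' Z"]
      skew[of "br X Y" Z] skew[of Y "br X Z"] that
    by (simp add: pa pd pa2 pd2 algebra_simps)
  moreover have "lie_deriv \<rho> (J' X) (pairing g Y Z) =
      pairing g X ((br (J' Y) Z + br Y (J' Z) - J' (br Y Z)) + (br (J' Z) Y + br Z (J' Y) - J' (br Z Y)))"
    if "X \<in> ?S" "Y \<in> ?S" "Z \<in> ?S" for X Y Z
    using ax2[of "J' X" Y Z] ld0[OF that] ax2[of X "J' Y" Z] ax2[of X Y "J' Z"]
      skew[of X "br Y Z"] skew[of X "br Z Y"] that
    by (simp add: pa pd pa2 pd2 algebra_simps)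
  ultimately show ?thesis
    unfolding \<Theta> deform_def pre_courant_def fst_conv snd_conv split_conv ldJ db
    by (simp add: bra brs J'a J's algebra_simps)
qed

corollary pre_courant_deforms:
  assumes "pre_courant_algebroid M E g \<Theta>" and "\<And>T. T \<in> set Ts \<Longrightarrow> skew_tensor11 M E g T"
  shows "pre_courant_algebroid M E g (deforms \<Theta> Ts)"
  using assms
proof (induction Ts arbitrary: \<Theta>)
  case (Cons T Ts)
  then have "pre_courant_algebroid M E g (deform \<Theta> T)"
    using pre_courant_deform[of M E g \<Theta> T] by (simp add: pre_courant_algebroid_def)
  with Cons show ?case by (simp add: deforms_def)
qed (simp add: deforms_def)

end

theory Submission
  imports Defs
begin

text \<open>
  An operator \<open>A\<close> acts on a bracket \<open>b\<close> in three ways, by \<open>l\<^sub>A b = b (A X) Y\<close>, \<open>r\<^sub>A b = b X (A Y)\<close> and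
  \<open>p\<^sub>A b = A (b X Y)\<close>, and operators belonging to different slots commute. The deformation by \<open>A\<close> is
  \<open>l\<^sub>A + r\<^sub>A - p\<^sub>A\<close>, the Nijenhuis torsion is \<open>(l\<^sub>A - p\<^sub>A) (r\<^sub>A - p\<^sub>A) b\<close>, and for anticommuting \<open>I\<close>, \<open>J\<close>
  the bracket of the concomitant \<open>C(I, J)\<close> is twice the polarisation
  \<open>(l\<^sub>I - p\<^sub>I) (r\<^sub>J - p\<^sub>J) b + (l\<^sub>J - p\<^sub>J) (r\<^sub>I - p\<^sub>I) b\<close> of the torsion, while its anchor vanishes
  automatically. Thus \<open>(I, J)\<close> is a Nijenhuis pair iff \<open>b\<close> is annihilated by three elements of the
  algebra generated by these operators, and everything reduces to showing that the elements
  expressing the conclusion lie in the left ideal they generate. It suffices to pass from \<open>b\<close> to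
  its deformation by \<open>I\<close>, from \<open>(I, J)\<close> to \<open>(I \<circ> J, J)\<close>, and from \<open>I\<close> to its odd powers.
\<close>

section \<open>Torsion-free pairs for a biadditive bracket\<close>

text \<open>One predicate serves operators on sections, maps of a fibre and each slot of a bracket;
  additivity is what identities with integer coefficients use.\<close>

definition endo_on :: "'a::real_vector set \<Rightarrow> ('a \<Rightarrow> 'a) \<Rightarrow> bool" where
  "endo_on S A \<longleftrightarrow> (\<forall>x\<in>S. A x \<in> S) \<and> (\<forall>x\<in>S. \<forall>y\<in>S. A (x + y) = A x + A y)"

text \<open>
  With \<open>A = B\<close> this is the Nijenhuis torsion. In the polarisation of two anticommuting operators the
  last terms \<open>A (B (b X Y))\<close> and \<open>B (A (b X Y))\<close> cancel.
\<close>

definition torsion ::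
    "('a::real_vector \<Rightarrow> 'a \<Rightarrow> 'a) \<Rightarrow> ('a \<Rightarrow> 'a) \<Rightarrow> ('a \<Rightarrow> 'a) \<Rightarrow> 'a \<Rightarrow> 'a \<Rightarrow> 'a" where
  "torsion b A B X Y = b (A X) (B Y) - A (b X (B Y)) - B (b (A X) Y) + A (B (b X Y))"

definition deformed :: "('a::real_vector \<Rightarrow> 'a \<Rightarrow> 'a) \<Rightarrow> ('a \<Rightarrow> 'a) \<Rightarrow> 'a \<Rightarrow> 'a \<Rightarrow> 'a" where
  "deformed b A X Y = b (A X) Y + b X (A Y) - A (b X Y)"

definition anticommuting_on :: "'a::real_vector set \<Rightarrow> ('a \<Rightarrow> 'a) \<Rightarrow> ('a \<Rightarrow> 'a) \<Rightarrow> bool" where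
  "anticommuting_on S A B \<longleftrightarrow> (\<forall>x\<in>S. A (B x) = - B (A x))"

section \<open>Additive maps of a subspace, their powers and anticommutation\<close>

lemma endo_on_simps:
  assumes "subspace S" "endo_on S A"
  shows "x \<in> S \<Longrightarrow> A x \<in> S"
    and "x \<in> S \<Longrightarrow> y \<in> S \<Longrightarrow> A (x + y) = A x + A y"
    and "x \<in> S \<Longrightarrow> y \<in> S \<Longrightarrow> A (x - y) = A x - A y"
    and "x \<in> S \<Longrightarrow> A (- x) = - A x"
    and "A 0 = 0"
proof -
  show in_S: "A x \<in> S" if "x \<in> S" for x
    using assms(2) that by (simp add: endo_on_def)
  show add: "A (x + y) = A x + A y" if "x \<in> S" "y \<in> S" for x y
    using assms(2) that by (simp add: endo_on_def)
  show zero: "A 0 = 0"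
    using add[of 0 0] subspace_0[OF assms(1)] by simp
  show diff: "A (x - y) = A x - A y" if "x \<in> S" "y \<in> S" for x y
    using add[of "x - y" y] subspace_diff[OF assms(1) that] that(2) by simp
  show "A (- x) = - A x" if "x \<in> S" for x
    using diff[of 0 x] subspace_0[OF assms(1)] that zero by simp
qed

lemma endo_on_comp: "endo_on S A \<Longrightarrow> endo_on S B \<Longrightarrow> endo_on S (A \<circ> B)"
  by (simp add: endo_on_def)

lemma endo_on_funpow: "endo_on S A \<Longrightarrow> endo_on S (A ^^ n)"
  by (induction n) (simp_all add: endo_on_def)

text \<open>Two further factors \<open>A\<close> change the sign twice.\<close>

lemma anticommuting_on_odd_funpow:
  assumes "subspace S" "endo_on S A" "endo_on S B" "anticommuting_on S A B"
  shows "anticommuting_on S (A ^^ (2 * m + 1)) B"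
proof (induction m)
  case 0
  show ?case using assms(4) by simp
next
  case (Suc m)
  then show ?case
    using assms(4)
    by (simp add: anticommuting_on_def endo_on_simps[OF assms(1,2)] endo_on_simps[OF assms(1,3)]
      endo_on_simps[OF assms(1) endo_on_funpow[OF assms(2)]])
qed

text \<open>The part of the Nijenhuis pair condition that concerns sections only. Skew-symmetry and
  the fibres are kept apart, so what follows is algebra over one biadditive map.\<close>

definition torsion_free_pair ::
    "'a::real_vector set \<Rightarrow> ('a \<Rightarrow> 'a \<Rightarrow> 'a) \<Rightarrow> ('a \<Rightarrow> 'a) \<Rightarrow> ('a \<Rightarrow> 'a) \<Rightarrow> bool" where
  "torsion_free_pair S b A B \<longleftrightarrow> endo_on S A \<and> endo_on S B \<and> anticommuting_on S A B \<and>
     (\<forall>X\<in>S. \<forall>Y\<in>S. torsion b A A X Y = 0 \<and> torsion b B B X Y = 0 \<and>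
        torsion b A B X Y + torsion b B A X Y = 0)"

lemma anticommuting_on_sym: "anticommuting_on S A B \<Longrightarrow> anticommuting_on S B A"
  by (simp add: anticommuting_on_def)

lemma torsion_free_pair_sym: "torsion_free_pair S b A B \<Longrightarrow> torsion_free_pair S b B A"
  by (simp add: torsion_free_pair_def anticommuting_on_sym add.commute)

locale biadditive_on =
  fixes S :: "'a::real_vector set" and b :: "'a \<Rightarrow> 'a \<Rightarrow> 'a"
  assumes subspace: "subspace S"
    and endo_left: "Y \<in> S \<Longrightarrow> endo_on S (\<lambda>X. b X Y)"
    and endo_right: "X \<in> S \<Longrightarrow> endo_on S (b X)"
begin

lemmas subspace_simps [simp] =
  subspace_0[OF subspace] subspace_add[OF subspace] subspace_diff[OF subspace] subspace_neg[OF subspace]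

lemmas left_simps [simp] = endo_on_simps[OF subspace endo_left]
lemmas right_simps [simp] = endo_on_simps(2-)[OF subspace endo_right]
lemmas endo_simps = endo_on_simps[OF subspace]

text \<open>This is the telescoping
  \<open>l_C l_A - p_A p_C = l_C (l_A - p_A) + p_A (l_C - p_C)\<close>, applied to
  \<open>(r_B - p_B) b\<close>.\<close>

lemma torsion_comp_left:
  assumes A: "endo_on S A" and B: "endo_on S B" and C: "endo_on S C" and "X \<in> S" "Y \<in> S"
  shows "torsion b (A \<circ> C) B X Y = torsion b A B (C X) Y + A (torsion b C B X Y)"
  using assms(4,5)
  by (simp add: torsion_def endo_simps[OF A] endo_simps[OF B] endo_simps[OF C])

text \<open>The same telescoping in the right slot; \<open>comm\<close> moves \<open>p_B\<close> in
  front of \<open>p_A\<close>.\<close>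

lemma torsion_comp_right:
  assumes A: "endo_on S A" and B: "endo_on S B" and C: "endo_on S C" and "X \<in> S" "Y \<in> S"
    and comm: "\<And>Z. Z \<in> S \<Longrightarrow> A (B Z) = B (A Z)"
  shows "torsion b A (B \<circ> C) X Y = torsion b A B X (C Y) + B (torsion b A C X Y)"
  using assms(4,5)
  by (simp add: torsion_def comm endo_simps[OF A] endo_simps[OF B] endo_simps[OF C])

lemma torsion_funpow_left:
  assumes A: "endo_on S A" and B: "endo_on S B"
    and t: "\<And>X Y. X \<in> S \<Longrightarrow> Y \<in> S \<Longrightarrow> torsion b A B X Y = 0" and "X \<in> S" "Y \<in> S"
  shows "torsion b (A ^^ n) B X Y = 0"
  using assms(4,5)
proof (induction n arbitrary: X)
  case 0
  then show ?case by (simp add: torsion_def)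
next
  case (Suc n)
  have "torsion b (A ^^ Suc n) B X Y = torsion b (A ^^ n) B (A X) Y + (A ^^ n) (torsion b A B X Y)"
    unfolding funpow_Suc_right using torsion_comp_left[OF endo_on_funpow[OF A] B A Suc.prems] .
  also have "\<dots> = 0"
    using Suc t endo_simps(1,5)[OF A] endo_simps(5)[OF endo_on_funpow[OF A]] by simp
  finally show ?case .
qed

lemma torsion_funpow:
  assumes A: "endo_on S A"
    and t: "\<And>X Y. X \<in> S \<Longrightarrow> Y \<in> S \<Longrightarrow> torsion b A A X Y = 0" and "X \<in> S" "Y \<in> S"
  shows "torsion b (A ^^ n) (A ^^ n) X Y = 0"
proof -
  \<comment> \<open>The two exponents are separated: the left one stays fixed while the right one
    grows by induction.\<close>
  have "torsion b (A ^^ n) (A ^^ k) X Y = 0" for k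
    using assms(3,4)
  proof (induction k arbitrary: Y)
    case 0
    then show ?case
      by (simp add: torsion_def)
  next
    case (Suc k)
    have comm: "(A ^^ n) ((A ^^ k) Z) = (A ^^ k) ((A ^^ n) Z)" for Z
      by (metis add.commute comp_apply funpow_add)
    have "torsion b (A ^^ n) A X Y = 0"
      using torsion_funpow_left[OF A A t] Suc.prems by simp
    moreover have "torsion b (A ^^ n) (A ^^ Suc k) X Y =
        torsion b (A ^^ n) (A ^^ k) X (A Y) + (A ^^ k) (torsion b (A ^^ n) A X Y)"
      unfolding funpow_Suc_right
      by (rule torsion_comp_right[OF endo_on_funpow[OF A] endo_on_funpow[OF A] A Suc.prems comm])
    moreover have "torsion b (A ^^ n) (A ^^ k) X (A Y) = 0"
      using Suc endo_simps(1)[OF A] by simp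
    ultimately show ?case
      using endo_simps(5)[OF endo_on_funpow[OF A]] by (simp del: funpow.simps)
  qed
  then show ?thesis .
qed

context
  fixes I J
  assumes I: "endo_on S I" and J: "endo_on S J" and anti: "anticommuting_on S I J"
begin

lemma anticomm: "x \<in> S \<Longrightarrow> I (J x) = - J (I x)"
  using anti by (simp add: anticommuting_on_def)

lemmas nf = torsion_def deformed_def anticomm endo_simps[OF I] endo_simps[OF J]

text \<open>Products within one slot cancel by anticommutation, and each product across two slots
  occurs twice.\<close>

lemma deformed_deformed_anticommuting:
  assumes "X \<in> S" "Y \<in> S"
  shows "deformed (deformed b I) J X Y + deformed (deformed b J) I X Y =
    2 *\<^sub>R (torsion b I J X Y + torsion b J I X Y)"
  using assms by (simp add: nf scaleR_2)

text \<open>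
  The right-hand sides below are left ideal membership certificates; they were found by linear
  algebra in the finite-dimensional space of monomials of the appropriate multidegree.
\<close>

lemma torsion_deformed_self:
  assumes "X \<in> S" "Y \<in> S"
  shows "torsion (deformed b I) I I X Y =
    torsion b I I (I X) Y + torsion b I I X (I Y) - I (torsion b I I X Y)"
  using assms by (simp add: nf)

lemma torsion_deformed_other:
  assumes "X \<in> S" "Y \<in> S"
  shows "torsion (deformed b I) J J X Y =
    - torsion b J J (I X) Y - torsion b J J X (I Y) - I (torsion b J J X Y)
    - 2 *\<^sub>R J (torsion b I J X Y + torsion b J I X Y)"
  using assms by (simp add: nf scaleR_2)

lemma torsion_deformed_mixed:
  assumes "X \<in> S" "Y \<in> S"
  shows "torsion (deformed b I) I J X Y + torsion (deformed b I) J I X Y =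
    2 *\<^sub>R (torsion b I I X (J Y) + torsion b I I (J X) Y)
    + (torsion b I J X (I Y) + torsion b J I X (I Y)) + (torsion b I J (I X) Y + torsion b J I (I X) Y)
    + I (torsion b I J X Y + torsion b J I X Y)"
  using assms by (simp add: nf scaleR_2)

lemma torsion_comp_mixed:
  assumes "X \<in> S" "Y \<in> S"
  shows "torsion b (I \<circ> J) J X Y + torsion b J (I \<circ> J) X Y =
    - torsion b J J X (I Y) - torsion b J J (I X) Y - J (torsion b I J X Y + torsion b J I X Y)"
  using assms by (simp add: nf)

text \<open>The torsion of \<open>I\<close> at \<open>(J X, J Y)\<close> and that of
  \<open>J\<close> at \<open>(I X, I Y)\<close> both start with
  \<open>b (I (J X)) (I (J Y))\<close>, hence the factor 2.\<close>

lemma torsion_comp_self: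
  assumes "X \<in> S" "Y \<in> S"
  shows "2 *\<^sub>R torsion b (I \<circ> J) (I \<circ> J) X Y =
      torsion b I I (J X) (J Y) - J (torsion b I I X (J Y)) - J (torsion b I I (J X) Y)
      - J (J (torsion b I I X Y))
    + torsion b J J (I X) (I Y) - I (torsion b J J X (I Y)) - I (torsion b J J (I X) Y)
      - I (I (torsion b J J X Y))"
  using assms by (simp add: nf scaleR_2)

text \<open>The induction step for odd powers, with \<open>A\<close> an odd power of
  \<open>I\<close>: the last summand carries the induction hypothesis, the others the hypotheses on
  \<open>I\<close> and \<open>J\<close>. The exponent grows by two because even powers of
  \<open>I\<close> commute with \<open>J\<close>.\<close>

lemma torsion_comp_square_mixed:
  assumes A: "endo_on S A" and anti_A: "anticommuting_on S A J"
    and comm: "\<And>x. x \<in> S \<Longrightarrow> A (I x) = I (A x)" and "X \<in> S" "Y \<in> S"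
  shows "torsion b (A \<circ> I \<circ> I) J X Y + torsion b J (A \<circ> I \<circ> I) X Y =
    J (torsion b I I X (A Y)) + J (torsion b I I (A X) Y)
    - torsion b I I X (A (J Y)) - torsion b I I (A (J X)) Y
    + (torsion b I J X (A (I Y)) + torsion b J I X (A (I Y)))
    + (torsion b I J (A (I X)) Y + torsion b J I (A (I X)) Y)
    + I (torsion b I J X (A Y) + torsion b J I X (A Y))
    + I (torsion b I J (A X) Y + torsion b J I (A X) Y)
    + I (I (torsion b A J X Y + torsion b J A X Y))"
proof -
  have "x \<in> S \<Longrightarrow> A (J x) = - J (A x)" for x
    using anti_A by (simp add: anticommuting_on_def)
  then show ?thesis
    using assms(4,5) by (simp add: nf endo_simps[OF A] comm)
qed

end

section \<open>Torsion-free pairs under deformation, composition and odd powers\<close>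

lemma torsion_free_pair_deformed:
  assumes "torsion_free_pair S b A B"
  shows "torsion_free_pair S (deformed b A) A B"
proof -
  note p = assms[unfolded torsion_free_pair_def]
  have A: "endo_on S A" and B: "endo_on S B" and anti: "anticommuting_on S A B"
    using p by auto
  show ?thesis
    unfolding torsion_free_pair_def
    using p
    by (simp add: torsion_deformed_self[OF A B anti] torsion_deformed_other[OF A B anti]
      torsion_deformed_mixed[OF A B anti] endo_simps[OF A] endo_simps[OF B])
qed

lemma torsion_free_pair_comp:
  assumes "torsion_free_pair S b A B"
  shows "torsion_free_pair S b (A \<circ> B) B"
proof -
  note p = assms[unfolded torsion_free_pair_def]
  have A: "endo_on S A" and B: "endo_on S B" and anti: "anticommuting_on S A B"
    using p by auto
  have "2 *\<^sub>R torsion b (A \<circ> B) (A \<circ> B) X Y = 0" if "X \<in> S" "Y \<in> S" for X Y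
    unfolding torsion_comp_self[OF A B anti that]
    using p that by (simp add: endo_simps[OF A] endo_simps[OF B])
  moreover have "torsion b (A \<circ> B) B X Y + torsion b B (A \<circ> B) X Y = 0" if "X \<in> S" "Y \<in> S" for X Y
    unfolding torsion_comp_mixed[OF A B anti that]
    using p that by (simp add: endo_simps[OF A] endo_simps[OF B])
  moreover have "anticommuting_on S (A \<circ> B) B"
    using anti by (simp add: anticommuting_on_def endo_simps[OF B])
  ultimately show ?thesis
    unfolding torsion_free_pair_def using p endo_on_comp[OF A B] by simp
qed

lemma torsion_free_pair_odd_funpow:
  assumes "torsion_free_pair S b A B"
  shows "torsion_free_pair S b (A ^^ (2 * m + 1)) B"
proof -
  note p = assms[unfolded torsion_free_pair_def]
  have A: "endo_on S A" and B: "endo_on S B" and anti: "anticommuting_on S A B"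
    using p by auto
  have "torsion b (A ^^ (2 * m + 1)) B X Y + torsion b B (A ^^ (2 * m + 1)) X Y = 0"
    if "X \<in> S" "Y \<in> S" for X Y
    using that
  proof (induction m arbitrary: X Y)
    case 0
    then show ?case using p by simp
  next
    case (Suc m)
    let ?P = "A ^^ (2 * m + 1)"
    have P: "endo_on S ?P" by (rule endo_on_funpow[OF A])
    have comm: "?P (A x) = A (?P x)" for x by (simp add: funpow_swap1)
    have eq: "A ^^ (2 * Suc m + 1) = ?P \<circ> A \<circ> A"
      by (simp add: fun_eq_iff funpow_swap1)
    note aP = anticommuting_on_odd_funpow[OF subspace A B anti, of m]
    have in_S: "A (?P Z) \<in> S" "?P Z \<in> S" "?P (A Z) \<in> S" "?P (B Z) \<in> S" if "Z \<in> S" for Z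
      using that by (simp_all only: endo_simps(1)[OF P] endo_simps(1)[OF A] endo_simps(1)[OF B])
    show ?case
      unfolding eq torsion_comp_square_mixed[OF A B anti P aP comm Suc.prems]
      using p Suc by (simp only: in_S endo_simps[OF A] endo_simps[OF B] add_0_right diff_0_right)
  qed
  then show ?thesis
    unfolding torsion_free_pair_def
    using p endo_on_funpow[OF A] anticommuting_on_odd_funpow[OF subspace A B anti]
      torsion_funpow[OF A]
    by (simp del: funpow.simps)
qed

end

section \<open>Nijenhuis pairs as torsion-free pairs on sections\<close>

lemma endo_on_section:
  assumes "smooth_manifold M" "vector_bundle M E" "tensor11 M E A"
  shows "endo_on (sections M E) (on_section A)"
  unfolding endo_on_def
proof (intro conjI ballI)
  show "on_section A X \<in> sections M E" if "X \<in> sections M E" for X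
    by (rule on_section_in_sections[OF assms that])
  show "on_section A (X + Y) = on_section A X + on_section A Y"
    if "X \<in> sections M E" "Y \<in> sections M E" for X Y
    using assms(3) that by (auto simp: on_section_def bundle_map_def sections_def fun_eq_iff)
qed

lemma endo_on_fibre: "tensor11 M E A \<Longrightarrow> endo_on (fibre E x) (A x)"
  by (simp add: endo_on_def bundle_map_def)

lemma subspace_sections:
  assumes "smooth_manifold M" "vector_bundle M E"
  shows "subspace (sections M E)"
  unfolding subspace_def
proof (intro conjI ballI allI)
  show "0 \<in> sections M E"
    using fibre_subspace[OF assms(2)]
    by (auto simp: sections_def subspace_0 intro!: exI[of _ "\<lambda>_ _. 0"] smooth_on_const)
  show "X + Y \<in> sections M E" if "X \<in> sections M E" "Y \<in> sections M E" for X Y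
    by (rule sections_add[OF assms that])
  show "c *\<^sub>R X \<in> sections M E" if "X \<in> sections M E" for X c
    using sections_lincomb[OF assms that that, of c 0] by simp
qed

lemma biadditive_on_sections:
  assumes "pre_courant_algebroid M E g \<Theta>"
  shows "biadditive_on (sections M E) (snd \<Theta>)"
proof
  show "subspace (sections M E)"
    using assms by (simp add: pre_courant_algebroid_def subspace_sections)
  show "endo_on (sections M E) (\<lambda>X. snd \<Theta> X Y)" if "Y \<in> sections M E" for Y
    using assms that
    by (auto simp: pre_courant_algebroid_def pre_courant_def endo_on_def split_beta)
  show "endo_on (sections M E) (snd \<Theta> X)" if "X \<in> sections M E" for X
    using assms that
    by (auto simp: pre_courant_algebroid_def pre_courant_def endo_on_def split_beta)
qed

lemma on_section_bcomp: "on_section (A \<circ>\<^sub>b B) = on_section A \<circ> on_section B"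
  by (simp add: on_section_def bcomp_def fun_eq_iff)

lemma on_section_bpow: "on_section (bpow A n) = on_section A ^^ n"
proof (induction n)
  case 0
  show ?case by (simp add: on_section_def bpow_def fun_eq_iff)
next
  case (Suc n)
  have "on_section (bpow A (Suc n)) = on_section A \<circ> on_section (bpow A n)"
    by (simp add: on_section_def bpow_def fun_eq_iff)
  then show ?case by (simp add: Suc)
qed

lemma snd_deform: "snd (deform \<Theta> A) = deformed (snd \<Theta>) (on_section A)"
  by (simp add: deform_def deform_bracket_def deformed_def fun_eq_iff)

lemma nijenhuis_iff_torsion:
  assumes "pre_courant_algebroid M E g \<Theta>" "tensor11 M E A"
  shows "nijenhuis M E \<Theta> A \<longleftrightarrow> (\<forall>X\<in>sections M E. \<forall>Y\<in>sections M E.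
    torsion (snd \<Theta>) (on_section A) (on_section A) X Y = 0)"
proof -
  interpret biadditive_on "sections M E" "snd \<Theta>"
    by (rule biadditive_on_sections[OF assms(1)])
  have A: "endo_on (sections M E) (on_section A)"
    using assms by (simp add: pre_courant_algebroid_def endo_on_section)
  have "snd \<Theta> (on_section A X) (on_section A Y) - on_section A (snd (deform \<Theta> A) X Y) =
      torsion (snd \<Theta>) (on_section A) (on_section A) X Y"
    if "X \<in> sections M E" "Y \<in> sections M E" for X Y
    using that by (simp add: snd_deform deformed_def torsion_def endo_simps[OF A])
  then show ?thesis
    by (simp add: nijenhuis_def)
qed

lemma vanishes_concomitant_iff:
  assumes \<Theta>: "pre_courant_algebroid M E g \<Theta>" and A: "tensor11 M E A" and B: "tensor11 M E B"
    and anti: "\<And>x. anticommuting_on (fibre E x) (A x) (B x)"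
  shows "vanishes M E (concomitant \<Theta> A B) \<longleftrightarrow> (\<forall>X\<in>sections M E. \<forall>Y\<in>sections M E.
    torsion (snd \<Theta>) (on_section A) (on_section B) X Y +
    torsion (snd \<Theta>) (on_section B) (on_section A) X Y = 0)"
proof -
  interpret biadditive_on "sections M E" "snd \<Theta>"
    by (rule biadditive_on_sections[OF \<Theta>])
  have M: "smooth_manifold M" and E: "vector_bundle M E" and "pre_courant M E g \<Theta>"
    using \<Theta> by (simp_all add: pre_courant_algebroid_def)
  then have \<rho>: "bundle_map M E (tangent_bundle M) (fst \<Theta>)"
    by (simp add: pre_courant_def split_beta)
  have sA: "endo_on (sections M E) (on_section A)" and sB: "endo_on (sections M E) (on_section B)"
    by (rule endo_on_section[OF M E A], rule endo_on_section[OF M E B])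
  have "anticommuting_on (sections M E) (on_section A) (on_section B)"
    using anti by (auto simp: anticommuting_on_def sections_def on_section_def fun_eq_iff)
  note bracket = deformed_deformed_anticommuting[OF sA sB this]
  have "fst (concomitant \<Theta> A B) x u = 0" if u: "u \<in> fibre E x" for x u
  proof -
    have v: "B x (A x u) \<in> fibre E x"
      using endo_on_fibre[OF A, of x] endo_on_fibre[OF B, of x] u by (simp add: endo_on_def)
    \<comment> \<open>Negation is scaling by -1, so homogeneity of the anchor takes the sign
      out.\<close>
    have "fst \<Theta> x (-1 *\<^sub>R B x (A x u)) = -1 *\<^sub>R fst \<Theta> x (B x (A x u))"
      using \<rho> v unfolding bundle_map_def by blast
    then have "fst \<Theta> x (A x (B x u)) = - fst \<Theta> x (B x (A x u))"
      using anti[of x] u by (simp add: anticommuting_on_def)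
    then show ?thesis
      by (simp add: concomitant_def deforms_def deform_def bcomp_def)
  qed
  moreover have "snd (concomitant \<Theta> A B) X Y =
      2 *\<^sub>R (torsion (snd \<Theta>) (on_section A) (on_section B) X Y +
        torsion (snd \<Theta>) (on_section B) (on_section A) X Y)"
    if "X \<in> sections M E" "Y \<in> sections M E" for X Y
    using bracket[OF that] by (simp add: concomitant_def deforms_def snd_deform)
  ultimately show ?thesis
    by (simp add: vanishes_def)
qed

text \<open>The bridge from geometry to algebra. Anticommutation is recorded on fibres as well: it
  passes from fibres to sections pointwise, while the converse would require extending fibre vectors
  to global sections.\<close>

lemma nijenhuis_pair_iff:
  assumes \<Theta>: "pre_courant_algebroid M E g \<Theta>"
  shows "nijenhuis_pair M E g \<Theta> A B \<longleftrightarrow>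
    skew_tensor11 M E g A \<and> skew_tensor11 M E g B \<and>
    (\<forall>x. anticommuting_on (fibre E x) (A x) (B x)) \<and>
    torsion_free_pair (sections M E) (snd \<Theta>) (on_section A) (on_section B)"
proof -
  have ME: "smooth_manifold M" "vector_bundle M E"
    using \<Theta> by (simp_all add: pre_courant_algebroid_def)
  have anti: "(\<forall>x. \<forall>u\<in>fibre E x. (A \<circ>\<^sub>b B) x u = - (B \<circ>\<^sub>b A) x u) \<longleftrightarrow>
      (\<forall>x. anticommuting_on (fibre E x) (A x) (B x))"
    by (simp add: anticommuting_on_def bcomp_def)
  have sections: "anticommuting_on (sections M E) (on_section A) (on_section B)"
    if "\<forall>x. anticommuting_on (fibre E x) (A x) (B x)"
    using that by (auto simp: anticommuting_on_def sections_def on_section_def fun_eq_iff)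
  show ?thesis
  proof (cases "skew_tensor11 M E g A \<and> skew_tensor11 M E g B \<and>
      (\<forall>x. anticommuting_on (fibre E x) (A x) (B x))")
    case True
    then have A: "tensor11 M E A" and B: "tensor11 M E B"
      by (simp_all add: skew_tensor11_def)
    show ?thesis
      using True sections vanishes_concomitant_iff[OF \<Theta> A B] nijenhuis_iff_torsion[OF \<Theta> A]
        nijenhuis_iff_torsion[OF \<Theta> B] endo_on_section[OF ME A] endo_on_section[OF ME B]
      unfolding nijenhuis_pair_def compatible_pair_def anti torsion_free_pair_def by blast
  next
    case False
    then show ?thesis
      unfolding nijenhuis_pair_def compatible_pair_def anti by blast
  qed
qed

section \<open>Closure properties of Nijenhuis pairs\<close>

lemma tensor11_bcomp:
  assumes "smooth_manifold M" "vector_bundle M E" "tensor11 M E A" "tensor11 M E B"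
  shows "tensor11 M E (A \<circ>\<^sub>b B)"
  using bundle_map_bcomp[OF assms(1,2) _ _ assms(4,3)] vector_bundleD[OF assms(2)] by blast

lemma skew_tensor11D:
  assumes "skew_tensor11 M E g A" "fibre_metric M E g" "u \<in> fibre E x" "v \<in> fibre E x"
  shows "g x (A x u) v = - g x u (A x v)"
  using assms by (auto simp: skew_tensor11_def eq_neg_iff_add_eq_0)

lemma fibre_metric_minus_right:
  assumes "fibre_metric M E g" "vector_bundle M E" "u \<in> fibre E x" "v \<in> fibre E x"
  shows "g x u (- v) = - g x u v"
proof -
  have "- v \<in> fibre E x"
    using fibre_subspace[OF assms(2)] assms(4) by (rule subspace_neg)
  then show ?thesis
    using fibre_metricD(2)[OF assms(1,4,3), of "-1"] fibre_metricD(3)[OF assms(1)] assms(3,4)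
    by simp
qed

text \<open>The two signs cancel, so the adjoint of \<open>A B\<close> is \<open>B A\<close>, which
  anticommutation turns into \<open>- A B\<close>.\<close>

lemma skew_tensor11_bcomp:
  assumes M: "smooth_manifold M" and E: "vector_bundle M E" and g: "fibre_metric M E g"
    and A: "skew_tensor11 M E g A" and B: "skew_tensor11 M E g B"
    and anti: "\<And>x. anticommuting_on (fibre E x) (A x) (B x)"
  shows "skew_tensor11 M E g (A \<circ>\<^sub>b B)"
proof -
  have tA: "tensor11 M E A" and tB: "tensor11 M E B"
    using A B by (simp_all add: skew_tensor11_def)
  have "g x (A x (B x u)) v + g x u (A x (B x v)) = 0"
    if u: "u \<in> fibre E x" and v: "v \<in> fibre E x" for x u v
  proof -
    have f: "A x w \<in> fibre E x" "B x w \<in> fibre E x" if "w \<in> fibre E x" for w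
      using endo_on_fibre[OF tA, of x] endo_on_fibre[OF tB, of x] that by (simp_all add: endo_on_def)
    have "g x (A x (B x u)) v = g x u (B x (A x v))"
      using u v f by (simp add: skew_tensor11D[OF A g] skew_tensor11D[OF B g])
    moreover have "A x (B x v) = - B x (A x v)"
      using anti[of x] v by (simp add: anticommuting_on_def)
    ultimately show ?thesis
      using u v f by (simp add: fibre_metric_minus_right[OF g E])
  qed
  then show ?thesis
    using tensor11_bcomp[OF M E tA tB] by (simp add: skew_tensor11_def bcomp_def)
qed

lemma bpow_Suc: "bpow A (Suc n) = A \<circ>\<^sub>b bpow A n"
  by (simp add: bpow_def bcomp_def fun_eq_iff)

lemma skew_tensor11_odd_bpow:
  assumes M: "smooth_manifold M" and E: "vector_bundle M E" and g: "fibre_metric M E g"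
    and A: "skew_tensor11 M E g A"
  shows "skew_tensor11 M E g (bpow A (2 * m + 1))"
proof -
  have tA: "tensor11 M E A"
    using A by (simp add: skew_tensor11_def)
  \<comment> \<open>Since \<open>2 * m + 1\<close> is positive, the induction may start from
    \<open>A\<close> itself rather than from the identity.\<close>
  have "tensor11 M E (bpow A (Suc k))" for k
  proof (induction k)
    case 0
    show ?case using tA by (simp add: bpow_def)
  next
    case (Suc k)
    then show ?case
      unfolding bpow_Suc[of A "Suc k"] by (rule tensor11_bcomp[OF M E tA])
  qed
  \<comment> \<open>Each factor moved across the form costs a sign; an odd exponent leaves one
    minus.\<close>
  moreover have "g x ((A x ^^ k) u) v = (-1) ^ k * g x u ((A x ^^ k) v)"
    if "u \<in> fibre E x" "v \<in> fibre E x" for x u v k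
    using that
  proof (induction k arbitrary: v)
    case (Suc k)
    have "(A x ^^ k) u \<in> fibre E x" "A x v \<in> fibre E x"
      using endo_on_fibre[OF tA, of x] endo_on_funpow[OF endo_on_fibre[OF tA, of x], of k] Suc.prems
      by (simp_all add: endo_on_def)
    then show ?case
      using Suc by (simp add: skew_tensor11D[OF A g] funpow_swap1[of "A x" k v])
  qed simp
  ultimately show ?thesis
    by (simp add: skew_tensor11_def bpow_def del: funpow.simps)
qed

section \<open>Nijenhuis pairs under swapping, deformation, composition and odd powers\<close>

lemma nijenhuis_pair_sym:
  assumes "pre_courant_algebroid M E g \<Theta>" "nijenhuis_pair M E g \<Theta> A B"
  shows "nijenhuis_pair M E g \<Theta> B A"
  using assms(2) unfolding nijenhuis_pair_iff[OF assms(1)]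
  by (simp add: torsion_free_pair_sym anticommuting_on_sym)

text \<open>The first claim lets \<open>nijenhuis_pair_iff\<close> be applied to the deformed
  structure, and deformations be iterated.\<close>

lemma nijenhuis_pair_deform:
  assumes \<Theta>: "pre_courant_algebroid M E g \<Theta>" and p: "nijenhuis_pair M E g \<Theta> A B"
  shows "pre_courant_algebroid M E g (deform \<Theta> A)"
    and "nijenhuis_pair M E g (deform \<Theta> A) A B"
proof -
  note p' = p[unfolded nijenhuis_pair_iff[OF \<Theta>]]
  show \<Theta>': "pre_courant_algebroid M E g (deform \<Theta> A)"
    using \<Theta> pre_courant_deform[OF \<Theta>] p' by (simp add: pre_courant_algebroid_def)
  show "nijenhuis_pair M E g (deform \<Theta> A) A B"
    unfolding nijenhuis_pair_iff[OF \<Theta>'] snd_deform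
    using p' biadditive_on.torsion_free_pair_deformed[OF biadditive_on_sections[OF \<Theta>]] by blast
qed

lemma nijenhuis_pair_deforms:
  assumes "pre_courant_algebroid M E g \<Theta>" "nijenhuis_pair M E g \<Theta> A B" "set Ts \<subseteq> {A, B}"
  shows "pre_courant_algebroid M E g (deforms \<Theta> Ts) \<and> nijenhuis_pair M E g (deforms \<Theta> Ts) A B"
  using assms
proof (induction Ts arbitrary: \<Theta>)
  case Nil
  then show ?case by (simp add: deforms_def)
next
  case (Cons T Ts)
  consider "T = A" | "T = B"
    using Cons.prems(3) by auto
  then have "pre_courant_algebroid M E g (deform \<Theta> T) \<and> nijenhuis_pair M E g (deform \<Theta> T) A B"
  proof cases
    case 1
    then show ?thesis using nijenhuis_pair_deform[OF Cons.prems(1,2)] by simp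
  next
    case 2
    \<comment> \<open>Deforming by the second member is deforming the swapped pair by its
      first.\<close>
    note BA = nijenhuis_pair_deform[OF Cons.prems(1) nijenhuis_pair_sym[OF Cons.prems(1,2)]]
    show ?thesis using 2 BA(1) nijenhuis_pair_sym[OF BA] by simp
  qed
  then show ?case
    using Cons by (simp add: deforms_def)
qed

lemma nijenhuis_pair_bcomp:
  assumes \<Theta>: "pre_courant_algebroid M E g \<Theta>" and p: "nijenhuis_pair M E g \<Theta> A B"
  shows "nijenhuis_pair M E g \<Theta> (A \<circ>\<^sub>b B) B"
proof -
  note p' = p[unfolded nijenhuis_pair_iff[OF \<Theta>]]
  have ME: "smooth_manifold M" "vector_bundle M E" "fibre_metric M E g"
    using \<Theta> by (simp_all add: pre_courant_algebroid_def)
  have "endo_on (fibre E x) (B x)" for x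
    using p' unfolding skew_tensor11_def by (blast intro: endo_on_fibre)
  then have "anticommuting_on (fibre E x) ((A \<circ>\<^sub>b B) x) (B x)" for x
    using p' by (simp add: anticommuting_on_def bcomp_def endo_on_def)
  then show ?thesis
    unfolding nijenhuis_pair_iff[OF \<Theta>] on_section_bcomp
    using p' skew_tensor11_bcomp[OF ME]
      biadditive_on.torsion_free_pair_comp[OF biadditive_on_sections[OF \<Theta>]] by blast
qed

lemma nijenhuis_pair_bcomp_bpow:
  assumes \<Theta>: "pre_courant_algebroid M E g \<Theta>" and p: "nijenhuis_pair M E g \<Theta> A B"
  shows "nijenhuis_pair M E g \<Theta> (A \<circ>\<^sub>b bpow B n) B"
proof (induction n)
  case 0
  have "A \<circ>\<^sub>b bpow B 0 = A"
    by (simp add: bcomp_def bpow_def fun_eq_iff)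
  then show ?case using p by simp
next
  case (Suc n)
  \<comment> \<open>The new factor is put on the right, so that the pair already obtained is
    composed with its second member.\<close>
  have "A \<circ>\<^sub>b bpow B (Suc n) = (A \<circ>\<^sub>b bpow B n) \<circ>\<^sub>b B"
    by (simp add: bcomp_def bpow_def fun_eq_iff funpow_swap1)
  then show ?case using nijenhuis_pair_bcomp[OF \<Theta> Suc] by simp
qed

lemma nijenhuis_pair_odd_bpow:
  assumes \<Theta>: "pre_courant_algebroid M E g \<Theta>" and p: "nijenhuis_pair M E g \<Theta> A B"
  shows "nijenhuis_pair M E g \<Theta> (bpow A (2 * m + 1)) B"
proof -
  note p' = p[unfolded nijenhuis_pair_iff[OF \<Theta>]]
  have ME: "smooth_manifold M" "vector_bundle M E" "fibre_metric M E g"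
    using \<Theta> by (simp_all add: pre_courant_algebroid_def)
  have "endo_on (fibre E x) (A x)" "endo_on (fibre E x) (B x)" for x
    using p' unfolding skew_tensor11_def by (blast intro: endo_on_fibre)+
  then have "anticommuting_on (fibre E x) (bpow A (2 * m + 1) x) (B x)" for x
    unfolding bpow_def using p' fibre_subspace[OF ME(2)] by (blast intro: anticommuting_on_odd_funpow)
  then show ?thesis
    unfolding nijenhuis_pair_iff[OF \<Theta>] on_section_bpow
    using p' skew_tensor11_odd_bpow[OF ME]
      biadditive_on.torsion_free_pair_odd_funpow[OF biadditive_on_sections[OF \<Theta>]] by blast
qed

theorem theorem4p11:
  fixes M :: "'m::{t2_space,second_countable_topology} manifold"
    and E :: "('m, 'v::real_vector) vbundle"
    and g :: "'m \<Rightarrow> 'v \<Rightarrow> 'v \<Rightarrow> real"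
    and \<Theta> :: "('m, 'v) struct"
    and I J :: "'m \<Rightarrow> 'v \<Rightarrow> 'v"
  assumes "pre_courant_algebroid M E g \<Theta>"
    and "skew_tensor11 M E g I" and "skew_tensor11 M E g J"
    and "nijenhuis_pair M E g \<Theta> I J"
  shows "\<forall>m n t :: nat. \<forall>Ts. set Ts \<subseteq> {I, J} \<longrightarrow>
           nijenhuis_pair M E g (deforms \<Theta> Ts)
             (bpow I (2 * m + 1) \<circ>\<^sub>b bpow J n) (bpow J (2 * t + 1))"
proof (intro allI impI)
  fix m n t :: nat and Ts
  assume "set Ts \<subseteq> {I, J}"
  then have \<Theta>': "pre_courant_algebroid M E g (deforms \<Theta> Ts)"
    and "nijenhuis_pair M E g (deforms \<Theta> Ts) I J"
    using nijenhuis_pair_deforms[OF assms(1,4)] by blast+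
  \<comment> \<open>The odd power of \<open>I\<close> comes first; composing with powers of
    \<open>J\<close> needs \<open>J\<close> itself as second member, so the power of
    \<open>J\<close> there is taken last.\<close>
  then have "nijenhuis_pair M E g (deforms \<Theta> Ts) (bpow I (2 * m + 1) \<circ>\<^sub>b bpow J n) J"
    using nijenhuis_pair_odd_bpow nijenhuis_pair_bcomp_bpow by blast
  then show "nijenhuis_pair M E g (deforms \<Theta> Ts)
      (bpow I (2 * m + 1) \<circ>\<^sub>b bpow J n) (bpow J (2 * t + 1))"
    \<comment> \<open>Swapping puts \<open>J\<close> in the place where odd powers are taken; a
      second swap restores the order.\<close>
    using \<Theta>' nijenhuis_pair_sym nijenhuis_pair_odd_bpow by blast
qed

end
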